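(* Let $r\ge1$, $n\ge 1$ be integers and let $L(t,u_0,u_1,\ldots,u_r)$, $L:\mathbb{T}\times(\mathbb{R}^n)^{r+1}\to\mathbb{R}$, be a $C^{r+1}$ function of $(u_0,\ldots,u_r)$ for each $t\in\mathbb{T}$. Suppose $y_\ast\in C^r_{rd}[\mathbb{T}]$ is a weak local minimizer for the higher-order problem $$\mathcal{L}[y(\cdot)]=\int_a^{\rho^{r-1}(b)}L(t,y(t),y^\Delta(t),\ldots,y^{\Delta^r}(t))\,\Delta t\longrightarrow\min,$$ $$\left(y^{\Delta^i}(a)=y_a^i\right),\quad \left(y^{\Delta^i}(\rho^{r-1}(b))=y_b^i\right),\qquad i=0,\ldots,r-1,$$ where each of the boundary conditions in parentheses may or may not be present. Put $x_\ast(t)=(y_\ast(t),y_\ast^\Delta(t),\ldots,y_\ast^{\Delta^{r-1}}(t))$ and $u_\ast(t)=y_\ast^{\Delta^r}(t)$. Then there exist constants $c_0,\ldots,c_{r-1}\in\mathbb{R}^n$ such that, for the functions $\psi_\ast^0,\ldots,\psi_\ast^{r-1}$ on $[a,\rho^{r-1}(b)]\cap\mathbb{T}$ defined recursively by $$\psi_\ast^0(t)=-\int_a^{t}L_{y^0}(\xi,x_\ast(\xi),u_\ast(\xi))\,\Delta\xi+c_0,$$ $$\psi_\ast^i(t)=-\int_a^{t}\left[L_{y^i}(\xi,x_\ast(\xi),u_\ast(\xi))+\psi_\ast^{i-1}(\sigma(\xi))\right]\Delta\xi+c_i,\qquad i=1,\ldots,r-1,$$ the equation $$\psi_\ast^{r-1}(\sigma(t))=-L_u(t,x_\ast(t),u_\ast(t))$$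 holds for all $t\in\mathbb{T}^{k^r}$; and, for every $i\in\{0,\ldots,r-1\}$ and $\alpha\in\{a,\rho^{r-1}(b)\}$ such that $y^{\Delta^i}(\alpha)$ is free in the problem (the corresponding boundary condition is not present), the condition $\psi_\ast^i(\alpha)=0$ holds.
   Context: A time scale is a nonempty closed subset of $\mathbb{R}$. Throughout $\mathbb{T}=[a,b]\cap\mathbb{T}_0$ with $a<b$ and $\mathbb{T}_0$ a time scale, where $a=\min\mathbb{T}$ and $b=\max\mathbb{T}$; it is assumed that $\mathbb{T}$ has at least $2r+1$ points. The forward jump operator is $\sigma(t)=\inf\{s\in\mathbb{T}:s>t\}$ (with $\sigma(b)=b$), the backward jump operator is $\rho(t)=\sup\{s\in\mathbb{T}:s<t\}$ (with $\rho(a)=a$); $\rho^0(t)=t$, $\rho^j=\rho\circ\rho^{j-1}$. A point $t$ is right-dense if $\sigma(t)=t$, left-dense if $\rho(t)=t$. $\mathbb{T}^k=\mathbb{T}\setminus(\rho(b),b]$ and $\mathbb{T}^{k^j}=(\mathbb{T}^{k^{j-1}})^k$; in particular $\mathbb{T}^{k^{j}}=[a,\rho^{j}(b)]\cap\mathbb{T}$. A function $f$ on $\mathbb{T}$ is delta differentiable at $t\in\mathbb{T}^k$ with delta derivative $f^\Delta(t)$ if for all $\varepsilon>0$ there is a neighborhood $U=(t-\delta,t+\delta)\cap\mathbb{T}$ with $|f(\sigma(t))-f(s)-f^\Delta(t)(\sigma(t)-s)|\le\varepsilon|\sigma(t)-s|$ for all $s\in U$. The $r$-th delta derivative $f^{\Delta^r}:\mathbb{T}^{k^r}\to\mathbb{R}^n$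 is the delta derivative of $f^{\Delta^{r-1}}$, with $f^{\Delta^0}=f$. A function is rd-continuous if it is continuous at right-dense points and its left-sided limit exists at left-dense points. $C^r_{rd}[\mathbb{T}]$ is the set of functions $y:\mathbb{T}\to\mathbb{R}^n$ whose $r$-th delta derivative $y^{\Delta^r}$ exists and is rd-continuous on $\mathbb{T}^{k^r}$. The delta integral is $\int_c^d f(t)\Delta t=F(d)-F(c)$ where $F^\Delta=f$. $L_{y^i}$ ($0\le i\le r-1$) and $L_u$ denote the partial derivatives (gradients) of $L(t,u_0,\ldots,u_r)$ with respect to $u_i$ and $u_r$, respectively. $y_\ast\in C^r_{rd}[\mathbb{T}]$ is a weak local minimizer if it satisfies the boundary conditions present and there exists $\delta>0$ such that $\mathcal{L}[y_\ast]\le\mathcal{L}[y]$ for all $y\in C^r_{rd}[\mathbb{T}]$ satisfying the boundary conditions present and $\|y-y_\ast\|_{r,\infty}<\delta$, where $\|y\|_{r,\infty}=\sum_{i=0}^r\|y^{\Delta^i}\|_\infty$ and $\|f\|_\infty=\sup_{t\in\mathbb{T}^{k^r}}|f(t)|$.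
   Formalization: The formal theorem additionally assumes that L and its first partial gradients L_{y^i}, L_u are rd-continuous in t jointly with (u_0,…,u_r) on the time scale [a,ρ^{r-1}(b)]∩T; without regularity in t the delta integrals defining the functional and ψ^i need not exist. *)

theory Defs
  imports "HOL-Analysis.Analysis"
begin

section \<open>Delta calculus on a compact time scale\<close>

text \<open>The guards implement the conventions \<open>\<sigma>(max) = max\<close> and \<open>\<rho>(min) = min\<close>.\<close>

definition sigma :: "real set \<Rightarrow> real \<Rightarrow> real" where
  "sigma T t = (if \<exists>s\<in>T. t < s then Inf {s\<in>T. t < s} else t)"

definition rho :: "real set \<Rightarrow> real \<Rightarrow> real" where
  "rho T t = (if \<exists>s\<in>T. s < t then Sup {s\<in>T. s < t} else t)"

definition kappa :: "real set \<Rightarrow> real set" where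
  "kappa T = T - {rho T (Sup T)<..Sup T}"

definition has_delta_derivative ::
    "real set \<Rightarrow> (real \<Rightarrow> 'a::real_normed_vector) \<Rightarrow> 'a \<Rightarrow> real \<Rightarrow> bool" where
  "has_delta_derivative T f D t \<longleftrightarrow>
     (\<forall>\<epsilon>>0. \<exists>\<delta>>0. \<forall>s\<in>T \<inter> {t - \<delta><..<t + \<delta>}.
        norm (f (sigma T t) - f s - (sigma T t - s) *\<^sub>R D) \<le> \<epsilon> * \<bar>sigma T t - s\<bar>)"

definition delta_deriv ::
    "real set \<Rightarrow> (real \<Rightarrow> 'a::real_normed_vector) \<Rightarrow> real \<Rightarrow> 'a" where
  "delta_deriv T f t = (THE D. has_delta_derivative T f D t)"

text \<open>
  The derivative of order \<open>j\<close> lives on the time scale \<open>(kappa ^^ j) T\<close>, so the next derivative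
  is taken with respect to that time scale and its own jump operator. The two jump operators
  differ only at the maximum of \<open>(kappa ^^ j) T\<close>, where the value of \<open>sigma T\<close> may lie outside
  the domain of the derivative of order \<open>j\<close>.
\<close>

primrec delta_deriv_n ::
    "real set \<Rightarrow> nat \<Rightarrow> (real \<Rightarrow> 'a::real_normed_vector) \<Rightarrow> real \<Rightarrow> 'a" where
  "delta_deriv_n T 0 f = f"
| "delta_deriv_n T (Suc j) f = delta_deriv ((kappa ^^ j) T) (delta_deriv_n T j f)"

definition delta_integral ::
    "real set \<Rightarrow> (real \<Rightarrow> 'a::real_normed_vector) \<Rightarrow> real \<Rightarrow> real \<Rightarrow> 'a" where
  "delta_integral T f c d =
     (THE I. \<exists>F. (\<forall>t\<in>kappa T. has_delta_derivative T F (f t) t) \<and> I = F d - F c)"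

text \<open>
  Rd-continuity of a function with domain \<open>kappa T\<close>, such as a delta derivative on \<open>T\<close>. The
  notions right-dense and left-dense refer to \<open>T\<close>, not to \<open>kappa T\<close>: the maximum of \<open>kappa T\<close> may
  be right-scattered in \<open>T\<close>.
\<close>

definition rd_continuous ::
    "real set \<Rightarrow> (real \<Rightarrow> 'a::t2_space) \<Rightarrow> bool" where
  "rd_continuous T f \<longleftrightarrow>
     (\<forall>t\<in>kappa T.
        (sigma T t = t \<longrightarrow> continuous (at t within kappa T) f) \<and>
        (rho T t = t \<longrightarrow> (\<exists>l. (f \<longlongrightarrow> l) (at t within (kappa T \<inter> {..<t})))))"

text \<open>
  The same notion for a function that depends on \<open>t\<close> and on a further variable \<open>u\<close>, jointly
  in both: if \<open>w\<close> is rd-continuous then so is the function \<open>t \<mapsto> g t (w t)\<close>.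
\<close>

definition rd_continuous_param ::
    "real set \<Rightarrow> (real \<Rightarrow> 'b::metric_space \<Rightarrow> 'a::t2_space) \<Rightarrow> bool" where
  "rd_continuous_param T g \<longleftrightarrow>
     (\<forall>t\<in>kappa T. \<forall>u.
        (sigma T t = t \<longrightarrow>
           continuous (at (t, u) within (kappa T \<times> UNIV)) (\<lambda>(s, v). g s v)) \<and>
        (rho T t = t \<longrightarrow>
           (\<exists>l. ((\<lambda>(s, v). g s v) \<longlongrightarrow> l) (at (t, u) within ((kappa T \<inter> {..<t}) \<times> UNIV)))))"

definition C_rd ::
    "real set \<Rightarrow> nat \<Rightarrow> (real \<Rightarrow> 'a::real_normed_vector) set" where
  "C_rd T r = {y.
     (\<forall>j<r. \<forall>t\<in>(kappa ^^ Suc j) T.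
        \<exists>D. has_delta_derivative ((kappa ^^ j) T) (delta_deriv_n T j y) D t) \<and>
     rd_continuous ((kappa ^^ (r - 1)) T) (delta_deriv_n T r y)}"

definition norm_r_inf ::
    "real set \<Rightarrow> nat \<Rightarrow> (real \<Rightarrow> 'a::real_normed_vector) \<Rightarrow> real" where
  "norm_r_inf T r y = (\<Sum>i\<le>r. SUP t\<in>(kappa ^^ r) T. norm (delta_deriv_n T i y t))"


section \<open>Functions of several vector variables\<close>

primrec Ck :: "nat \<Rightarrow> ('a::euclidean_space \<Rightarrow> real) \<Rightarrow> bool" where
  "Ck 0 f \<longleftrightarrow> continuous_on UNIV f"
| "Ck (Suc k) f \<longleftrightarrow>
     f differentiable_on UNIV \<and> (\<forall>v\<in>Basis. Ck k (\<lambda>x. frechet_derivative f (at x) v))"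

text \<open>The gradient of \<open>f\<close> with respect to the vector variable \<open>u $ j\<close>.\<close>

definition partial_grad ::
    "(real^'n^'m \<Rightarrow> real) \<Rightarrow> 'm \<Rightarrow> real^'n^'m \<Rightarrow> real^'n" where
  "partial_grad f j u = (\<chi> k. frechet_derivative f (at u) (axis j (axis k 1)))"


section \<open>The higher-order variational problem\<close>

text \<open>
  A tuple \<open>(u\<^sub>0, \<dots>, u\<^sub>r)\<close> of vectors in \<open>\<real>\<^sup>n\<close> is an element of \<open>real^'n^'m\<close>, where
  \<open>e\<close> is a bijection from \<open>{..r}\<close> onto the index type \<open>'m\<close> and \<open>u\<^sub>i\<close> is the component \<open>e i\<close>.
  The jet at \<open>t\<close> is the tuple of the values at \<open>t\<close> of \<open>y\<close> and its first \<open>r\<close> delta derivatives.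
\<close>

definition jet ::
    "real set \<Rightarrow> nat \<Rightarrow> (nat \<Rightarrow> 'm) \<Rightarrow> (real \<Rightarrow> real^'n) \<Rightarrow> real \<Rightarrow> real^'n^'m" where
  "jet T r e y t = (\<Sum>i\<le>r. axis (e i) (delta_deriv_n T i y t))"

definition lagrangian_functional ::
    "real set \<Rightarrow> nat \<Rightarrow> (nat \<Rightarrow> 'm) \<Rightarrow> (real \<Rightarrow> real^'n^'m \<Rightarrow> real) \<Rightarrow> (real \<Rightarrow> real^'n) \<Rightarrow> real"
  where
  "lagrangian_functional T r e L y =
     delta_integral ((kappa ^^ (r - 1)) T) (\<lambda>t. L t (jet T r e y t))
       (Inf T) ((rho T ^^ (r - 1)) (Sup T))"

text \<open>
  \<open>A\<close> and \<open>B\<close> are the sets of those orders \<open>i\<close> for which the boundary condition at the left,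
  respectively right, endpoint is present.
\<close>

definition boundary_conditions ::
    "real set \<Rightarrow> nat \<Rightarrow> nat set \<Rightarrow> nat set \<Rightarrow> (nat \<Rightarrow> 'a) \<Rightarrow> (nat \<Rightarrow> 'a) \<Rightarrow>
       (real \<Rightarrow> 'a::real_normed_vector) \<Rightarrow> bool" where
  "boundary_conditions T r A B ya yb y \<longleftrightarrow>
     (\<forall>i<r. (i \<in> A \<longrightarrow> delta_deriv_n T i y (Inf T) = ya i) \<and>
            (i \<in> B \<longrightarrow> delta_deriv_n T i y ((rho T ^^ (r - 1)) (Sup T)) = yb i))"

definition weak_local_minimizer ::
    "real set \<Rightarrow> nat \<Rightarrow> (nat \<Rightarrow> 'm) \<Rightarrow> (real \<Rightarrow> real^'n^'m \<Rightarrow> real) \<Rightarrow> nat set \<Rightarrow> nat set \<Rightarrow>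
       (nat \<Rightarrow> real^'n) \<Rightarrow> (nat \<Rightarrow> real^'n) \<Rightarrow> (real \<Rightarrow> real^'n) \<Rightarrow> bool" where
  "weak_local_minimizer T r e L A B ya yb z \<longleftrightarrow>
     z \<in> C_rd T r \<and> boundary_conditions T r A B ya yb z \<and>
     (\<exists>\<delta>>0. \<forall>y\<in>C_rd T r.
        boundary_conditions T r A B ya yb y \<and> norm_r_inf T r (\<lambda>t. y t - z t) < \<delta> \<longrightarrow>
        lagrangian_functional T r e L z \<le> lagrangian_functional T r e L y)"

end

theory Submission
  imports Defs
begin

text \<open>
  Write \<open>T\<^sub>j\<close> for the \<open>j\<close>-fold iterate of \<open>kappa\<close> applied to \<open>T\<close>, \<open>\<beta>\<close> for the maximum of
  \<open>T\<^sub>r\<^sub>-\<^sub>1\<close>, and \<open>h\<^sub>i\<close> for the delta derivative of order \<open>i\<close> of a variation \<open>h\<close>. Minimality makes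
  the first variation \<open>\<Lambda>(h) = \<integral> \<Sum>\<^sub>i L\<^sub>i \<bullet> h\<^sub>i\<close> vanish as soon as the constrained ones among the numbers
  \<open>h\<^sub>i(a)\<close>, \<open>h\<^sub>i(\<beta>)\<close> vanish. These are finitely many linear functionals of \<open>h\<close>, so \<open>\<Lambda>\<close> is a linear
  combination of them (\<open>boundary_multipliers\<close>):
  \<open>\<Lambda>(h) = \<Sum>\<^sub>i \<mu>\<^sub>i \<bullet> h\<^sub>i(a) + \<Sum>\<^sub>i \<nu>\<^sub>i \<bullet> h\<^sub>i(\<beta>)\<close>, where \<open>\<mu>\<^sub>i = 0\<close> and \<open>\<nu>\<^sub>i = 0\<close> for the free orders.

  Let \<open>\<psi>\<close> solve the adjoint equations with terminal values \<open>\<psi>\<^sub>i(\<beta>) = - \<nu>\<^sub>i\<close>. Differentiating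
  \<open>\<Sum>\<^sub>i \<psi>\<^sub>i \<bullet> h\<^sub>i\<close> gives a telescoping sum, and integrating it
  (\<open>adjoint_green_identity\<close>) turns the formula for \<open>\<Lambda>\<close> into
  \<open>\<integral> q \<bullet> h\<^sub>r = \<Sum>\<^sub>i (\<mu>\<^sub>i - \<psi>\<^sub>i(a)) \<bullet> h\<^sub>i(a)\<close> with \<open>q = \<psi>\<^sub>r\<^sub>-\<^sub>1 \<circ> \<sigma> + L\<^sub>u\<close>.
  The top derivative \<open>h\<^sub>r\<close> and the initial values \<open>h\<^sub>i(a)\<close> can be prescribed independently
  (\<open>derivative_chain_exists\<close>). Zero initial values and \<open>h\<^sub>r = q\<close> give \<open>\<integral> |q|\<^sup>2 = 0\<close>; an antiderivative
  of \<open>|q|\<^sup>2\<close> is then monotone with equal end values, hence constant, so \<open>q = 0\<close> at every point.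
  Arbitrary initial values then give \<open>\<psi>\<^sub>i(a) = \<mu>\<^sub>i\<close>. Both transversality conditions are the vanishing
  of the multipliers of free orders.

  The analysis behind this consists of three facts. Antiderivatives are unique up to
  a constant, because a function with nonnegative delta derivative is nondecreasing (\<open>delta_mono\<close>),
  which is proved by induction along the time scale. Rd-continuous functions have antiderivatives
  (\<open>rd_continuous_antiderivative\<close>): an ordinary integral of the step extension is one. Finally, \<open>h\<^sub>i\<close> is
  differentiated on \<open>T\<^sub>i\<close>, while the pairing with \<open>\<psi>\<close> takes place on \<open>T\<^sub>r\<^sub>-\<^sub>1\<close>, whose jump operator differs at
  the maximum; the derivative survives this restriction because it is continuous
  (\<open>has_delta_derivative_kappa\<close>).
\<close>

section \<open>Jump operators\<close>

text \<open>
  Two points are required because on a one-point set every vector is a delta derivative of every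
  function.
\<close>
definition time_scale :: "real set \<Rightarrow> bool" where
  "time_scale T \<longleftrightarrow> compact T \<and> (\<exists>s\<in>T. \<exists>t\<in>T. s < t)"

lemma time_scale_compact: "time_scale T \<Longrightarrow> compact T"
  by (simp add: time_scale_def)

lemma time_scale_closed: "time_scale T \<Longrightarrow> closed T"
  by (simp add: time_scale_def compact_imp_closed)

lemma time_scale_bdd:
  assumes "time_scale T" shows "bdd_above T" "bdd_below T" "T \<noteq> {}"
  using assms by (auto simp: time_scale_def compact_imp_bounded bounded_imp_bdd_above bounded_imp_bdd_below)

lemma Inf_in: "time_scale T \<Longrightarrow> Inf T \<in> T"
  and Sup_in: "time_scale T \<Longrightarrow> Sup T \<in> T"
  by (simp_all add: closed_contains_Inf closed_contains_Sup time_scale_closed time_scale_bdd)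

lemma Inf_le: "time_scale T \<Longrightarrow> t \<in> T \<Longrightarrow> Inf T \<le> t"
  and le_Sup: "time_scale T \<Longrightarrow> t \<in> T \<Longrightarrow> t \<le> Sup T"
  by (simp_all add: cInf_lower cSup_upper time_scale_bdd)

lemma Inf_less_Sup: "time_scale T \<Longrightarrow> Inf T < Sup T"
  by (metis Inf_le le_Sup time_scale_def order.strict_trans1 order.strict_trans2)

lemma sigma_ge: "time_scale T \<Longrightarrow> t \<le> sigma T t"
  unfolding sigma_def by (auto intro!: cInf_greatest)

lemma sigma_le: "time_scale T \<Longrightarrow> s \<in> T \<Longrightarrow> t < s \<Longrightarrow> sigma T t \<le> s"
  unfolding sigma_def
  by (auto intro!: cInf_lower bdd_belowI[where m=t])

lemma sigma_in:
  assumes T: "time_scale T" and t: "t \<in> T"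
  shows "sigma T t \<in> T"
proof (cases "\<exists>s\<in>T. t < s")
  case True
  let ?S = "{s\<in>T. t < s}"
  have "Inf ?S \<in> closure ?S"
    using True by (intro closure_contains_Inf) (auto intro!: bdd_belowI[where m=t])
  also have "closure ?S \<subseteq> T"
    by (rule closure_minimal) (auto simp: T time_scale_closed)
  finally show ?thesis using True by (simp add: sigma_def)
qed (use t in \<open>auto simp: sigma_def\<close>)

lemma rho_le: "time_scale T \<Longrightarrow> rho T t \<le> t"
  unfolding rho_def by (auto intro!: cSup_least)

lemma rho_ge: "time_scale T \<Longrightarrow> s \<in> T \<Longrightarrow> s < t \<Longrightarrow> s \<le> rho T t"
  unfolding rho_def
  by (auto intro!: cSup_upper bdd_aboveI[where M=t])

lemma rho_in:
  assumes T: "time_scale T" and t: "t \<in> T"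
  shows "rho T t \<in> T"
proof (cases "\<exists>s\<in>T. s < t")
  case True
  let ?S = "{s\<in>T. s < t}"
  have "Sup ?S \<in> closure ?S"
    using True by (intro closure_contains_Sup) (auto intro!: bdd_aboveI[where M=t])
  also have "closure ?S \<subseteq> T"
    by (rule closure_minimal) (auto simp: T time_scale_closed)
  finally show ?thesis using True by (simp add: rho_def)
qed (use t in \<open>auto simp: rho_def\<close>)

lemma rho_less_approx:
  assumes T: "time_scale T" and "s \<in> T" "s < t" "rho T t = t" "d > 0"
  shows "\<exists>s\<in>T. t - d < s \<and> s < t"
proof -
  have "t - d < Sup {s\<in>T. s < t}" using assms by (auto simp: rho_def split: if_splits)
  then show ?thesis
    using assms by (subst (asm) less_cSup_iff) (auto intro!: bdd_aboveI[where M=t])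
qed

lemma sigma_greater_approx:
  assumes T: "time_scale T" and "s \<in> T" "t < s" "sigma T t = t" "d > 0"
  shows "\<exists>s\<in>T. t < s \<and> s < t + d"
proof -
  have "Inf {s\<in>T. t < s} < t + d" using assms by (auto simp: sigma_def split: if_splits)
  then show ?thesis
    using assms by (subst (asm) cInf_less_iff) (auto intro!: bdd_belowI[where m=t])
qed

lemma sigma_Sup: "time_scale T \<Longrightarrow> sigma T (Sup T) = Sup T"
  using le_Sup by (force simp: sigma_def)

lemma sigma_gt_imp_less_Sup: "time_scale T \<Longrightarrow> t \<in> T \<Longrightarrow> t < sigma T t \<Longrightarrow> t < Sup T"
  using sigma_Sup[of T] le_Sup[of T t] by (cases "t = Sup T") auto

lemma mem_kappa_iff: "time_scale T \<Longrightarrow> t \<in> kappa T \<longleftrightarrow> t \<in> T \<and> t \<le> rho T (Sup T)"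
  using le_Sup by (auto simp: kappa_def)

lemma kappa_subset: "kappa T \<subseteq> T"
  by (auto simp: kappa_def)

lemma less_Sup_in_kappa: "time_scale T \<Longrightarrow> t \<in> T \<Longrightarrow> t < Sup T \<Longrightarrow> t \<in> kappa T"
  by (simp add: mem_kappa_iff rho_ge)

lemma left_dense_in_kappa:
  "time_scale T \<Longrightarrow> t \<in> T \<Longrightarrow> rho T t = t \<Longrightarrow> t \<in> kappa T"
  using less_Sup_in_kappa le_Sup by (fastforce simp: mem_kappa_iff)

text \<open>
  The maximum always satisfies \<open>\<sigma>(t) = t\<close>, by convention. It belongs to \<open>kappa T\<close> only if it is
  left-dense, and then points of \<open>T\<close> accumulate at it from the left.
\<close>
lemma kappa_right_dense:
  assumes T: "time_scale T" and t: "t \<in> kappa T" and "sigma T t = t"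
  shows "t islimpt T"
proof (cases "t < Sup T")
  case True
  show ?thesis unfolding islimpt_approachable_real
    using sigma_greater_approx[OF T Sup_in[OF T] True assms(3)] by force
next
  case False
  then have t': "t = Sup T" "rho T t = t"
    using t le_Sup[OF T, of t] rho_le[OF T, of t] by (auto simp: mem_kappa_iff[OF T])
  show ?thesis unfolding islimpt_approachable_real
    using rho_less_approx[OF T Inf_in[OF T] _ t'(2)] Inf_less_Sup[OF T] t' by force
qed

text \<open>Between \<open>\<rho>(t)\<close> and \<open>t\<close> there is no point of \<open>T\<close>, so jumping back from a left-scattered
  point can be undone. Induction along \<open>T\<close> uses this to reach left-scattered points.\<close>
lemma sigma_rho:
  assumes T: "time_scale T" and t: "t \<in> T" and "rho T t < t"
  shows "sigma T (rho T t) = t"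
proof (rule antisym)
  show "sigma T (rho T t) \<le> t" using assms sigma_le by blast
  have "t \<le> s" if "s \<in> T" "rho T t < s" for s using rho_ge[OF T that(1), of t] that(2) by linarith
  then have "t \<le> Inf {s\<in>T. rho T t < s}" using assms by (intro cInf_greatest) auto
  then show "t \<le> sigma T (rho T t)" using assms unfolding sigma_def by auto
qed

text \<open>
  Consider the infimum \<open>m\<close> of the points where \<open>P\<close> fails. Either the rule for left-dense points or a jump
  from \<open>\<rho>(m)\<close> shows \<open>P m\<close>, and then a jump or right-density pushes the failures away from \<open>m\<close>.
\<close>
lemma time_scale_induct [consumes 2, case_names min jump right left]:
  assumes T: "time_scale T" and u: "u \<in> T"
    and min: "P (Inf T)"
    and jump: "\<And>t. t \<in> T \<Longrightarrow> t < sigma T t \<Longrightarrow> P t \<Longrightarrow> P (sigma T t)"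
    and right: "\<And>t. t \<in> T \<Longrightarrow> t < Sup T \<Longrightarrow> sigma T t = t \<Longrightarrow> P t \<Longrightarrow>
      \<exists>d>0. \<forall>s\<in>T. t < s \<and> s < t + d \<longrightarrow> P s"
    and left: "\<And>t. t \<in> T \<Longrightarrow> Inf T < t \<Longrightarrow> rho T t = t \<Longrightarrow> (\<And>s. s \<in> T \<Longrightarrow> s < t \<Longrightarrow> P s) \<Longrightarrow> P t"
  shows "P u"
proof (rule ccontr)
  assume "\<not> P u"
  define S where "S = {t\<in>T. \<not> P t}"
  define m where "m = Inf S"
  have S: "S \<noteq> {}" "S \<subseteq> T" using \<open>\<not> P u\<close> u by (auto simp: S_def)
  have bdd: "bdd_below S" using bdd_below_mono[OF time_scale_bdd(2)[OF T] S(2)] .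
  have "m \<in> closure S" unfolding m_def using S bdd by (intro closure_contains_Inf)
  then have mT: "m \<in> T" using S closure_minimal time_scale_closed[OF T] by blast
  have below: "P s" if "s \<in> T" "s < m" for s
    using that cInf_lower[OF _ bdd, of s] by (auto simp: m_def S_def)
  have above: "m \<le> s" if "s \<in> S" for s using that bdd by (simp add: m_def cInf_lower)
  have "P m"
  proof -
    consider "m = Inf T" | "Inf T < m" "rho T m = m" | "rho T m < m"
      using Inf_le[OF T mT] rho_le[OF T, of m] by fastforce
    then show ?thesis
    proof cases
      case 3
      then show ?thesis
        using jump[of "rho T m"] below rho_in[OF T mT] sigma_rho[OF T mT] by simp
    qed (use min left mT below in auto)
  qed
  have gt: "m < s" if "s \<in> S" for s using above[OF that] \<open>P m\<close> that by (auto simp: S_def less_le)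
  obtain s0 where "s0 \<in> S" using S by blast
  have lt: "m < Sup T" using gt[OF \<open>s0 \<in> S\<close>] \<open>s0 \<in> S\<close> S le_Sup[OF T, of s0] by auto
  have "\<exists>d>0. \<forall>s\<in>S. m + d \<le> s"
  proof (cases "m < sigma T m")
    case True
    have "sigma T m \<le> s" if "s \<in> S" for s using sigma_le[OF T] gt[OF that] that S by blast
    then show ?thesis using True by (intro exI[of _ "sigma T m - m"]) auto
  next
    case False
    then obtain d where "d > 0" "\<forall>s\<in>T. m < s \<and> s < m + d \<longrightarrow> P s"
      using right[OF mT lt] sigma_ge[OF T, of m] \<open>P m\<close> by fastforce
    then show ?thesis using gt S by (force simp: S_def intro!: exI[of _ d])
  qed
  then obtain d where "d > 0" "\<forall>s\<in>S. m + d \<le> s" by blast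
  then have "m + d \<le> m" unfolding m_def using S by (intro cInf_greatest) auto
  with \<open>d > 0\<close> show False by simp
qed


section \<open>The delta derivative\<close>

text \<open>
  The point \<open>s = t\<close> has to be listed separately: it already determines the derivative when \<open>t\<close> is
  right-scattered, and the filter \<open>at t within T\<close> excludes it.
\<close>
lemma has_delta_derivative_eventually:
  assumes "t \<in> T"
  shows "has_delta_derivative T f D t \<longleftrightarrow>
    (\<forall>\<epsilon>>0. norm (f (sigma T t) - f t - (sigma T t - t) *\<^sub>R D) \<le> \<epsilon> * \<bar>sigma T t - t\<bar> \<and>
      (\<forall>\<^sub>F s in at t within T.
        norm (f (sigma T t) - f s - (sigma T t - s) *\<^sub>R D) \<le> \<epsilon> * \<bar>sigma T t - s\<bar>))"
proof -
  have "(\<exists>\<delta>>0. \<forall>s\<in>T \<inter> {t - \<delta><..<t + \<delta>}. Q s) \<longleftrightarrow> Q t \<and> (\<forall>\<^sub>F s in at t within T. Q s)" for Q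
  proof
    assume "\<exists>\<delta>>0. \<forall>s\<in>T \<inter> {t - \<delta><..<t + \<delta>}. Q s"
    then obtain d where d: "d > 0" "\<forall>s\<in>T \<inter> {t - d<..<t + d}. Q s" by blast
    then show "Q t \<and> (\<forall>\<^sub>F s in at t within T. Q s)"
      using assms unfolding eventually_at
      by (auto simp: dist_real_def abs_less_iff intro!: exI[of _ d])
  next
    assume "Q t \<and> (\<forall>\<^sub>F s in at t within T. Q s)"
    then obtain d where d: "d > 0" "\<forall>s\<in>T. s \<noteq> t \<and> dist s t < d \<longrightarrow> Q s" "Q t"
      unfolding eventually_at by blast
    then show "\<exists>\<delta>>0. \<forall>s\<in>T \<inter> {t - \<delta><..<t + \<delta>}. Q s"
      by (intro exI[of _ d]) (auto simp: dist_real_def abs_less_iff)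
  qed
  then show ?thesis by (simp only: has_delta_derivative_def all_conj_distrib)
qed

lemma has_delta_derivative_dense:
  assumes "t \<in> T" "sigma T t = t"
  shows "has_delta_derivative T f D t \<longleftrightarrow> (f has_vector_derivative D) (at t within T)"
proof -
  have "norm (f t - f s - (t - s) *\<^sub>R D) = norm (f s - f t - (s - t) *\<^sub>R D)" for s
    by (subst norm_minus_cancel[symmetric]) (simp add: algebra_simps)
  then show ?thesis
    unfolding has_vector_derivative_def has_derivative_within_alt2
      has_delta_derivative_eventually[OF assms(1)] assms(2)
    by (simp add: bounded_linear_scaleR_left abs_minus_commute[of t])
qed

text \<open>
  Together with \<open>has_delta_derivative_dense\<close> this reduces the calculus rules below to
  those for difference quotients and for vector derivatives.
\<close>
lemma has_delta_derivative_scattered: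
  assumes t: "t \<in> T" and st: "t < sigma T t"
  shows "has_delta_derivative T f D t \<longleftrightarrow>
    continuous (at t within T) f \<and> f (sigma T t) = f t + (sigma T t - t) *\<^sub>R D" (is "?L \<longleftrightarrow> ?R")
proof
  let ?k = "\<lambda>s. f (sigma T t) - f s - (sigma T t - s) *\<^sub>R D"
  assume ?L
  then have L: "norm (?k t) \<le> \<epsilon> * \<bar>sigma T t - t\<bar>"
      "\<forall>\<^sub>F s in at t within T. norm (?k s) \<le> \<epsilon> * \<bar>sigma T t - s\<bar>" if "\<epsilon> > 0" for \<epsilon>
    using that by (auto simp: has_delta_derivative_eventually[OF t])
  have "norm (?k t) / (sigma T t - t) \<le> 0 + \<epsilon>" if "\<epsilon> > 0" for \<epsilon>
    using L(1)[OF that] st by (simp add: field_simps)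
  then have "norm (?k t) / (sigma T t - t) \<le> 0" by (rule field_le_epsilon)
  then have "norm (?k t) \<le> 0" using st by (simp add: divide_le_0_iff)
  then have eq: "f (sigma T t) = f t + (sigma T t - t) *\<^sub>R D" by (simp add: algebra_simps)
  have "(?k \<longlongrightarrow> 0) (at t within T)"
  proof (rule tendstoI)
    fix e :: real assume e: "e > 0"
    define c where "c = sigma T t - t + 1"
    have c: "c > 0" using st by (simp add: c_def)
    have "\<forall>\<^sub>F s in at t within T. dist s t < 1" by (auto simp: eventually_at intro!: exI[of _ 1])
    moreover have "\<forall>\<^sub>F s in at t within T. norm (?k s) \<le> e / (2 * c) * \<bar>sigma T t - s\<bar>"
      using L(2)[of "e / (2 * c)"] e c by (simp del: times_divide_eq_left)
    ultimately show "\<forall>\<^sub>F s in at t within T. dist (?k s) 0 < e"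
    proof eventually_elim
      case (elim s)
      then have "\<bar>sigma T t - s\<bar> \<le> c" using st by (auto simp: c_def dist_real_def)
      then have "e / (2 * c) * \<bar>sigma T t - s\<bar> \<le> e / (2 * c) * c"
        using e c by (intro mult_left_mono) auto
      also have "\<dots> = e / 2" using c by simp
      finally have b: "e / (2 * c) * \<bar>sigma T t - s\<bar> \<le> e / 2" .
      have "norm (?k s) \<le> e / 2" using elim(2) b by (rule order_trans)
      then show ?case using e by simp
    qed
  qed
  then have "((\<lambda>s. f t + (s - t) *\<^sub>R D - ?k s) \<longlongrightarrow> f t + (t - t) *\<^sub>R D - 0) (at t within T)"
    by (intro tendsto_intros)
  moreover have "f t + (s - t) *\<^sub>R D - ?k s = f s" for s
  proof -
    have "f t + (s - t) *\<^sub>R D - ?k s = f s + ((s - t) + (sigma T t - s)) *\<^sub>R D - (sigma T t - t) *\<^sub>R D"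
      by (simp only: eq scaleR_add_left) simp
    then show ?thesis by simp
  qed
  ultimately have "(f \<longlongrightarrow> f t) (at t within T)" by simp
  with eq show ?R by (simp add: continuous_within)
next
  let ?k = "\<lambda>s. f (sigma T t) - f s - (sigma T t - s) *\<^sub>R D"
  assume R: ?R
  then have "(?k \<longlongrightarrow> f (sigma T t) - f t - (sigma T t - t) *\<^sub>R D) (at t within T)"
    unfolding continuous_within by (intro tendsto_intros) auto
  then have k: "(?k \<longlongrightarrow> 0) (at t within T)" using R by simp
  show ?L unfolding has_delta_derivative_eventually[OF t]
  proof (intro allI impI conjI)
    fix e :: real assume e: "e > 0"
    then show "norm (?k t) \<le> e * \<bar>sigma T t - t\<bar>" using R by simp
    let ?h = "(sigma T t - t) / 2"
    have "\<forall>\<^sub>F s in at t within T. dist (?k s) 0 < e * ?h"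
      using e st by (intro tendstoD[OF k]) auto
    moreover have "\<forall>\<^sub>F s in at t within T. dist s t < ?h"
      using st by (auto simp: eventually_at intro!: exI[of _ ?h])
    ultimately show "\<forall>\<^sub>F s in at t within T. norm (?k s) \<le> e * \<bar>sigma T t - s\<bar>"
    proof eventually_elim
      case (elim s)
      have "?h \<le> \<bar>sigma T t - s\<bar>" 
        using elim(2) abs_ge_self[of "sigma T t - s"] abs_ge_self[of "s - t"]
        unfolding dist_real_def by argo
      then have "e * ?h \<le> e * \<bar>sigma T t - s\<bar>" using e by (intro mult_left_mono) auto
      with elim show ?case by simp
    qed
  qed
qed

lemma has_delta_derivative_imp_continuous:
  assumes "time_scale T" "t \<in> T" "has_delta_derivative T f D t"
  shows "continuous (at t within T) f"
proof (cases "sigma T t = t")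
  case True
  then show ?thesis
    using assms has_delta_derivative_dense has_vector_derivative_continuous by blast
next
  case False
  then show ?thesis
    using assms sigma_ge[of T t] has_delta_derivative_scattered[of t T f D] by fastforce
qed

lemma has_delta_derivative_at_sigma:
  assumes "time_scale T" "t \<in> T" "has_delta_derivative T f D t"
  shows "f (sigma T t) = f t + (sigma T t - t) *\<^sub>R D"
proof (cases "sigma T t = t")
  case False
  then show ?thesis
    using assms sigma_ge[of T t] has_delta_derivative_scattered[of t T f D] by fastforce
qed simp

lemma has_delta_derivative_unique:
  assumes T: "time_scale T" and t: "t \<in> kappa T"
    and D: "has_delta_derivative T f D t" and D': "has_delta_derivative T f D' t"
  shows "D = D'"
proof (cases "sigma T t = t")
  case True
  have "t \<in> T" using t kappa_subset by blast
  moreover have "at t within T \<noteq> bot"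
    using kappa_right_dense[OF T t True] by (simp add: trivial_limit_within)
  ultimately show ?thesis
    using D D' True has_delta_derivative_dense[of t T f]
    by (auto intro: vector_derivative_unique_within)
next
  case False
  moreover have "t \<in> T" using t kappa_subset by blast
  ultimately show ?thesis
    using has_delta_derivative_at_sigma[OF T _ D] has_delta_derivative_at_sigma[OF T _ D'] by auto
qed

lemma delta_deriv_eqI:
  assumes "time_scale T" "t \<in> kappa T" "has_delta_derivative T f D t"
  shows "delta_deriv T f t = D"
  unfolding delta_deriv_def using assms has_delta_derivative_unique by blast

lemma has_delta_derivative_cong:
  assumes "time_scale T" "t \<in> T" "\<And>s. s \<in> T \<Longrightarrow> f s = g s"
  shows "has_delta_derivative T f D t \<longleftrightarrow> has_delta_derivative T g D t"
  unfolding has_delta_derivative_def using assms sigma_in[OF assms(1,2)] by auto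

lemma has_delta_derivative_const: "has_delta_derivative T (\<lambda>s. c) 0 t"
  by (auto simp: has_delta_derivative_def intro!: exI[of _ 1])

lemma has_delta_derivative_id: "has_delta_derivative T (\<lambda>s. s) 1 t"
  by (auto simp: has_delta_derivative_def intro!: exI[of _ 1])

lemma has_delta_derivative_bilinear:
  assumes T: "time_scale T" and t: "t \<in> T" and pr: "bounded_bilinear pr"
    and f: "has_delta_derivative T f D t" and g: "has_delta_derivative T g E t"
  shows "has_delta_derivative T (\<lambda>s. pr (f s) (g s)) (pr D (g t) + pr (f (sigma T t)) E) t"
proof (cases "sigma T t = t")
  case True
  then show ?thesis
    using f g bounded_bilinear.has_vector_derivative[OF pr, of f D t T g E]
    by (simp add: has_delta_derivative_dense[OF t True] add.commute)
next
  case False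
  then have s: "t < sigma T t" using sigma_ge[OF T, of t] by simp
  have c: "continuous (at t within T) (\<lambda>s. pr (f s) (g s))"
    using bounded_bilinear.continuous[OF pr has_delta_derivative_imp_continuous[OF T t f]
        has_delta_derivative_imp_continuous[OF T t g]] .
  interpret pr: bounded_bilinear pr by fact
  show ?thesis unfolding has_delta_derivative_scattered[OF t s]
    using c f g unfolding has_delta_derivative_scattered[OF t s]
    by (simp add: pr.add_left pr.add_right pr.scaleR_left pr.scaleR_right scaleR_add_right ac_simps)
qed

lemma has_delta_derivative_linear:
  assumes T: "time_scale T" and t: "t \<in> T" and h: "bounded_linear h"
    and f: "has_delta_derivative T f D t"
  shows "has_delta_derivative T (\<lambda>s. h (f s)) (h D) t"
proof (cases "sigma T t = t")
  case True
  then show ?thesis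
    using f bounded_linear.has_vector_derivative[OF h, of f D]
    by (simp add: has_delta_derivative_dense[OF t True])
next
  case False
  then have s: "t < sigma T t" using sigma_ge[OF T, of t] by simp
  have c: "continuous (at t within T) (\<lambda>s. h (f s))"
    using bounded_linear.continuous[OF h has_delta_derivative_imp_continuous[OF T t f]] .
  interpret h: bounded_linear h by fact
  show ?thesis
    using c f unfolding has_delta_derivative_scattered[OF t s] by (simp add: h.add h.scaleR)
qed

lemma has_delta_derivative_add:
  assumes T: "time_scale T" and t: "t \<in> T"
    and f: "has_delta_derivative T f D t" and g: "has_delta_derivative T g E t"
  shows "has_delta_derivative T (\<lambda>s. f s + g s) (D + E) t"
proof (cases "sigma T t = t")
  case True
  then show ?thesis using f g
    by (simp add: has_delta_derivative_dense[OF t True] has_vector_derivative_add)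
next
  case False
  then have s: "t < sigma T t" using sigma_ge[OF T, of t] by simp
  show ?thesis
    using f g unfolding has_delta_derivative_scattered[OF t s]
    by (simp add: continuous_add scaleR_add_right)
qed

lemma has_delta_derivative_scaleR:
  assumes "time_scale T" "t \<in> T" "has_delta_derivative T f D t"
  shows "has_delta_derivative T (\<lambda>s. c *\<^sub>R f s) (c *\<^sub>R D) t"
  using has_delta_derivative_linear[OF assms(1,2) bounded_linear_scaleR_right assms(3)] .

lemma has_delta_derivative_minus:
  assumes "time_scale T" "t \<in> T" "has_delta_derivative T f D t"
  shows "has_delta_derivative T (\<lambda>s. - f s) (- D) t"
  using has_delta_derivative_scaleR[OF assms, of "-1"] by simp

lemma has_delta_derivative_diff:
  assumes "time_scale T" "t \<in> T" "has_delta_derivative T f D t" "has_delta_derivative T g E t"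
  shows "has_delta_derivative T (\<lambda>s. f s - g s) (D - E) t"
  using has_delta_derivative_add[OF assms(1,2,3) has_delta_derivative_minus[OF assms(1,2,4)]]
  by simp

lemma has_delta_derivative_sum:
  assumes "time_scale T" "t \<in> T" "\<And>i. i \<in> I \<Longrightarrow> has_delta_derivative T (f i) (D i) t"
  shows "has_delta_derivative T (\<lambda>s. \<Sum>i\<in>I. f i s) (\<Sum>i\<in>I. D i) t"
proof (cases "finite I")
  case True
  then show ?thesis using assms(3)
  proof (induction I)
    case empty show ?case by (simp add: has_delta_derivative_const)
  next
    case (insert i I)
    then show ?case using has_delta_derivative_add[OF assms(1,2), of "f i" "D i"] by simp
  qed
qed (simp add: has_delta_derivative_const)


section \<open>Monotonicity and uniqueness of antiderivatives\<close>

text \<open>A point of \<open>T\<close> outside \<open>kappa T\<close> is an isolated maximum, where continuity is automatic.\<close>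
lemma has_delta_derivative_imp_continuous_on:
  assumes T: "time_scale T" and D: "\<And>t. t \<in> kappa T \<Longrightarrow> has_delta_derivative T F (D t) t"
  shows "continuous_on T F"
  unfolding continuous_on_eq_continuous_within
proof
  fix t assume t: "t \<in> T"
  show "continuous (at t within T) F"
  proof (cases "t \<in> kappa T")
    case True
    then show ?thesis using has_delta_derivative_imp_continuous[OF T t] D by blast
  next
    case False
    then have t_eq: "t = Sup T"
      using le_Sup[OF T t] less_Sup_in_kappa[OF T t] by linarith
    with False have "rho T t < t" using t by (simp add: mem_kappa_iff[OF T])
    moreover have "s = t \<or> s \<le> rho T t" if "s \<in> T" for s
      using rho_ge[OF T that, of t] le_Sup[OF T that] t_eq by linarith
    ultimately have "\<not> t islimpt T"
      unfolding islimpt_approachable_real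
      by (intro notI) (drule spec[of _ "t - rho T t"], fastforce)
    then show ?thesis by (simp add: continuous_within trivial_limit_within[symmetric])
  qed
qed

text \<open>
  For every \<open>\<epsilon> > 0\<close> the bound \<open>F s \<le> F t + \<epsilon> (t - s)\<close> propagates along \<open>T\<close>; the slack \<open>\<epsilon> (t - s)\<close>
  absorbs the error of the linear approximation at right-dense points. At left-dense points, the
  maximum included, continuity carries the bound; in \<open>has_delta_derivative_kappa\<close> continuity is all
  that is known at the maximum.
\<close>
lemma delta_mono:
  fixes F :: "real \<Rightarrow> real"
  assumes T: "time_scale T" and c: "continuous_on T F"
    and D: "\<And>t. t \<in> T \<Longrightarrow> t < Sup T \<Longrightarrow> has_delta_derivative T F (D t) t \<and> D t \<ge> 0"
    and s: "s \<in> T" and u: "u \<in> T" "s \<le> u"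
  shows "F s \<le> F u"
proof (rule field_le_epsilon)
  fix e :: real assume e: "e > 0"
  define \<epsilon> where "\<epsilon> = e / (u - s + 1)"
  have \<epsilon>: "\<epsilon> > 0" using e u by (simp add: \<epsilon>_def)
  define Q where "Q t \<longleftrightarrow> (s \<le> t \<longrightarrow> F s \<le> F t + \<epsilon> * (t - s))" for t
  have "Q u"
    using T u(1)
  proof (induction rule: time_scale_induct)
    case min
    then show ?case using Inf_le[OF T s] by (auto simp: Q_def)
  next
    case (jump t)
    have dt: "has_delta_derivative T F (D t) t" "D t \<ge> 0"
      using D[OF jump(1) sigma_gt_imp_less_Sup[OF T jump(1,2)]] by auto
    have "F t \<le> F (sigma T t)"
      using has_delta_derivative_at_sigma[OF T jump(1) dt(1)] dt(2) jump(2) by simp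
    moreover have "\<epsilon> * (t - s) \<le> \<epsilon> * (sigma T t - s)" using \<epsilon> jump by simp
    moreover have "s \<le> t \<or> s = sigma T t" if "s \<le> sigma T t"
      using sigma_le[OF T s, of t] that by linarith
    ultimately show ?case using jump(3) by (auto simp: Q_def)
  next
    case (right t)
    have dt: "has_delta_derivative T F (D t) t" "D t \<ge> 0" using D right by auto
    obtain d where d: "d > 0" "\<And>v. v \<in> T \<Longrightarrow> t - d < v \<Longrightarrow> v < t + d \<Longrightarrow>
        norm (F t - F v - (t - v) *\<^sub>R D t) \<le> \<epsilon> * \<bar>t - v\<bar>"
      using dt(1)[unfolded has_delta_derivative_def right(3), rule_format, OF \<epsilon>] by auto
    \<comment> \<open>For \<open>t < s\<close> the hypothesis at \<open>t\<close> says nothing, so the neighbourhood must stop short of \<open>s\<close>.\<close>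
    define d' where "d' = (if t < s then min d (s - t) else d)"
    have "Q v" if "v \<in> T" "t < v" "v < t + d'" for v
    proof -
      have "v < t + d" using that by (auto simp: d'_def split: if_splits)
      then have "\<bar>F t - F v - (t - v) * D t\<bar> \<le> \<epsilon> * (v - t)" using d(2)[of v] that d(1) by simp
      moreover have "(t - v) * D t \<le> 0" using dt(2) that by (simp add: mult_le_0_iff)
      ultimately have "F t \<le> F v + \<epsilon> * (v - t)" by linarith
      moreover have "s \<le> t" if "s \<le> v"
        using that \<open>v < t + d'\<close> by (auto simp: d'_def split: if_splits)
      ultimately show ?thesis using right(4) by (auto simp: Q_def algebra_simps)
    qed
    then show ?case using d(1) by (intro exI[of _ d']) (auto simp: d'_def)
  next
    case (left t)
    show ?case
    proof (cases "s < t")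
      case True
      have "\<forall>\<^sub>F v in at t within (T \<inter> {..<t}). s < v"
        using True by (auto simp: eventually_at dist_real_def intro!: exI[of _ "t - s"])
      then have ev: "\<forall>\<^sub>F v in at t within (T \<inter> {..<t}). F s \<le> F v + \<epsilon> * (v - s)"
        unfolding eventually_at_filter by eventually_elim (use left(4) in \<open>auto simp: Q_def\<close>)
      have "t islimpt T \<inter> {..<t}" unfolding islimpt_approachable_real
        using rho_less_approx[OF T Inf_in[OF T] left(2,3)] by force
      then have nb: "at t within (T \<inter> {..<t}) \<noteq> bot" by (simp add: trivial_limit_within)
      have "(F \<longlongrightarrow> F t) (at t within (T \<inter> {..<t}))"
        using c left(1) tendsto_within_subset by (fastforce simp: continuous_on)
      then have "((\<lambda>v. F v + \<epsilon> * (v - s)) \<longlongrightarrow> F t + \<epsilon> * (t - s)) (at t within (T \<inter> {..<t}))"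
        by (intro tendsto_intros)
      then show ?thesis using tendsto_lowerbound[OF _ ev nb] by (simp add: Q_def)
    qed (auto simp: Q_def)
  qed
  then have "F s \<le> F u + \<epsilon> * (u - s)" using u by (simp add: Q_def)
  also have "\<epsilon> * (u - s) \<le> e" using e u by (simp add: \<epsilon>_def field_simps)
  finally show "F s \<le> F u + e" by simp
qed

text \<open>The components of the difference of \<open>F\<close> and \<open>G\<close> in the directions \<open>v\<close> and \<open>- v\<close> are both nondecreasing.\<close>
lemma delta_antiderivative_unique:
  fixes F G :: "real \<Rightarrow> 'a::real_inner"
  assumes T: "time_scale T" and c: "continuous_on T F" "continuous_on T G"
    and D: "\<And>t. t \<in> T \<Longrightarrow> t < Sup T \<Longrightarrow>
      has_delta_derivative T F (f t) t \<and> has_delta_derivative T G (f t) t"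
    and s: "s \<in> T" and u: "u \<in> T"
  shows "F u - F s = G u - G s"
proof -
  define H where "H t = F t - G t" for t
  have H: "has_delta_derivative T H 0 t" if "t \<in> T" "t < Sup T" for t
    using has_delta_derivative_diff[OF T that(1)] D[OF that] unfolding H_def by fastforce
  have cH: "continuous_on T H" unfolding H_def using c by (intro continuous_intros)
  have le: "H s \<bullet> v \<le> H u \<bullet> v" if "s \<in> T" "u \<in> T" "s \<le> u" for v s u
  proof (rule delta_mono[OF T _ _ that, where D = "\<lambda>_. 0"])
    show "continuous_on T (\<lambda>t. H t \<bullet> v)" using cH by (intro continuous_intros)
    show "has_delta_derivative T (\<lambda>t. H t \<bullet> v) 0 t \<and> (0::real) \<le> 0" if "t \<in> T" "t < Sup T" for t
      using has_delta_derivative_linear[OF T that(1) bounded_linear_inner_left H[OF that], of v] by simp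
  qed
  have eq: "H s = H u" if "s \<in> T" "u \<in> T" "s \<le> u" for s u
  proof -
    have "H s \<bullet> v = H u \<bullet> v" for v
    proof (rule antisym[OF le[OF that]])
      show "H u \<bullet> v \<le> H s \<bullet> v" using le[OF that, of "- v"] by (simp only: inner_minus_right neg_le_iff_le)
    qed
    then show ?thesis by (rule vector_eq_rdot[THEN iffD1, OF allI])
  qed
  have "H s = H u" using le_cases[of s u] eq[OF s u] eq[OF u s, symmetric] by blast
  then show ?thesis by (simp add: H_def algebra_simps)
qed

lemma delta_integral_eq:
  fixes F :: "real \<Rightarrow> 'a::real_inner"
  assumes T: "time_scale T" and F: "\<And>t. t \<in> kappa T \<Longrightarrow> has_delta_derivative T F (f t) t"
    and "c \<in> T" "d \<in> T"
  shows "delta_integral T f c d = F d - F c"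
  unfolding delta_integral_def
proof (rule the_equality)
  show "\<exists>F'. (\<forall>t\<in>kappa T. has_delta_derivative T F' (f t) t) \<and> F d - F c = F' d - F' c"
    using F by blast
next
  fix I assume "\<exists>F'. (\<forall>t\<in>kappa T. has_delta_derivative T F' (f t) t) \<and> I = F' d - F' c"
  then obtain F' where F': "\<And>t. t \<in> kappa T \<Longrightarrow> has_delta_derivative T F' (f t) t"
    and I: "I = F' d - F' c" by blast
  show "I = F d - F c" unfolding I
    using F F' less_Sup_in_kappa[OF T] assms(3,4)
    by (intro delta_antiderivative_unique[OF T has_delta_derivative_imp_continuous_on[OF T F']
          has_delta_derivative_imp_continuous_on[OF T F], where f = f]) auto
qed


section \<open>Rd-continuous functions\<close>

lemma rd_continuous_right:
  "rd_continuous T f \<Longrightarrow> t \<in> kappa T \<Longrightarrow> sigma T t = t \<Longrightarrow> (f \<longlongrightarrow> f t) (at t within kappa T)"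
  by (simp add: rd_continuous_def continuous_within)

lemma rd_continuous_left:
  "rd_continuous T f \<Longrightarrow> t \<in> kappa T \<Longrightarrow> rho T t = t \<Longrightarrow>
    \<exists>l. (f \<longlongrightarrow> l) (at t within (kappa T \<inter> {..<t}))"
  by (simp add: rd_continuous_def)

lemma rd_continuous_cong:
  assumes "\<And>t. t \<in> kappa T \<Longrightarrow> f t = g t"
  shows "rd_continuous T f \<longleftrightarrow> rd_continuous T g"
proof -
  have "(f \<longlongrightarrow> l) (at t within (kappa T \<inter> A)) \<longleftrightarrow> (g \<longlongrightarrow> l) (at t within (kappa T \<inter> A))" for l t A
    by (rule filterlim_cong[OF refl refl]) (simp add: eventually_at_filter assms)
  from this[where A = UNIV] this show ?thesis
    by (simp add: rd_continuous_def continuous_within assms cong: ball_cong)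
qed

lemma continuous_imp_rd_continuous:
  assumes "continuous_on (kappa T) f"
  shows "rd_continuous T f"
  using assms unfolding rd_continuous_def continuous_on_eq_continuous_within
  by (meson continuous_within tendsto_within_subset inf_le1)

lemma rd_continuous_compose:
  fixes f :: "real \<Rightarrow> 'b::t2_space" and h :: "'b \<Rightarrow> 'c::t2_space"
  assumes f: "rd_continuous T f" and h: "continuous_on UNIV h"
  shows "rd_continuous T (\<lambda>t. h (f t))"
proof -
  have h': "((\<lambda>t. h (f t)) \<longlongrightarrow> h l) F" if "(f \<longlongrightarrow> l) F" for l F
    using that h isCont_tendsto_compose[of l h] by (simp add: continuous_on_eq_continuous_at)
  show ?thesis
    using f h' unfolding rd_continuous_def continuous_within by blast
qed

lemma rd_continuous_Pair:
  assumes "rd_continuous T f" "rd_continuous T g"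
  shows "rd_continuous T (\<lambda>t. (f t, g t))"
  using assms unfolding rd_continuous_def continuous_within by (blast intro: tendsto_Pair)

lemma rd_continuous_add:
  fixes f :: "real \<Rightarrow> 'a::real_normed_vector"
  assumes "rd_continuous T f" "rd_continuous T g"
  shows "rd_continuous T (\<lambda>t. f t + g t)"
  using rd_continuous_compose[OF rd_continuous_Pair[OF assms], of "\<lambda>p. fst p + snd p"]
  by (simp add: continuous_intros)

lemma rd_continuous_inner:
  fixes f :: "real \<Rightarrow> 'a::real_inner"
  assumes "rd_continuous T f" "rd_continuous T g"
  shows "rd_continuous T (\<lambda>t. f t \<bullet> g t)"
  using rd_continuous_compose[OF rd_continuous_Pair[OF assms], of "\<lambda>p. fst p \<bullet> snd p"]
  by (simp add: continuous_intros)

lemma rd_continuous_linear: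
  assumes "rd_continuous T f" "bounded_linear h"
  shows "rd_continuous T (\<lambda>t. h (f t))"
  using rd_continuous_compose[OF assms(1)] linear_continuous_on[OF assms(2)] by blast

lemma rd_continuous_const: "rd_continuous T (\<lambda>t. c)"
  by (simp add: continuous_imp_rd_continuous)

lemma rd_continuous_sum:
  fixes f :: "'i \<Rightarrow> real \<Rightarrow> 'a::real_normed_vector"
  assumes "\<And>i. i \<in> I \<Longrightarrow> rd_continuous T (f i)"
  shows "rd_continuous T (\<lambda>t. \<Sum>i\<in>I. f i t)"
proof (cases "finite I")
  case True
  then show ?thesis using assms
    by (induction I) (auto simp: rd_continuous_const rd_continuous_add)
qed (simp add: rd_continuous_const)

text \<open>
  Although \<open>\<sigma>\<close> jumps at left-dense right-scattered points, it tends to \<open>t\<close> from the left at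
  every left-dense \<open>t\<close> and from both sides at right-dense points.
\<close>
lemma rd_continuous_sigma:
  assumes T: "time_scale T" and f: "continuous_on T f"
  shows "rd_continuous T (\<lambda>t. f (sigma T t))"
proof -
  have f': "((\<lambda>s. f (sigma T s)) \<longlongrightarrow> f t) (at t within A)"
    if A: "A \<subseteq> T" and t: "t \<in> T" and s: "(sigma T \<longlongrightarrow> t) (at t within A)" for t A
  proof (rule continuous_on_tendsto_compose[OF f s t])
    show "\<forall>\<^sub>F s in at t within A. sigma T s \<in> T"
      unfolding eventually_at_filter using A sigma_in[OF T] by (intro always_eventually) blast
  qed
  have left: "(sigma T \<longlongrightarrow> t) (at t within (kappa T \<inter> {..<t}))" if "t \<in> T" for t
  proof (rule tendsto_sandwich)
    show "\<forall>\<^sub>F s in at t within (kappa T \<inter> {..<t}). s \<le> sigma T s"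
      by (simp add: sigma_ge[OF T])
    show "\<forall>\<^sub>F s in at t within (kappa T \<inter> {..<t}). sigma T s \<le> t"
      using sigma_le[OF T that] by (auto simp: eventually_at_filter)
  qed (auto intro: tendsto_ident_at)
  have right: "(sigma T \<longlongrightarrow> t) (at t within kappa T)" if t: "t \<in> kappa T" "sigma T t = t" for t
  proof (rule tendstoI)
    fix e :: real assume e: "e > 0"
    have tT: "t \<in> T" using t kappa_subset by blast
    have "\<exists>d>0. \<forall>s\<in>kappa T. t < s \<and> s < t + d \<longrightarrow> sigma T s < t + e"
    proof (cases "t < Sup T")
      case True
      then obtain v where v: "v \<in> T" "t < v" "v < t + e"
        using sigma_greater_approx[OF T Sup_in[OF T] True t(2) e] by blast
      then show ?thesis using sigma_le[OF T v(1)]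
        by (intro exI[of _ "v - t"]) (fastforce intro: le_less_trans)
    next
      case False
      then show ?thesis using le_Sup[OF T] kappa_subset e
        by (intro exI[of _ 1]) fastforce
    qed
    then obtain d where d: "d > 0" "\<And>s. s \<in> kappa T \<Longrightarrow> t < s \<Longrightarrow> s < t + d \<Longrightarrow> sigma T s < t + e"
      by blast
    have "dist (sigma T s) t < e" if s: "s \<in> kappa T" "s \<noteq> t" "dist s t < min d e" for s
    proof (cases "t < s")
      case True
      then have "sigma T s < t + e" "s \<le> sigma T s"
        using d(2)[OF s(1) True] s(3) sigma_ge[OF T] by (auto simp: dist_real_def)
      then show ?thesis using True by (simp add: dist_real_def)
    next
      case False
      then have "s < t" using s by simp
      then have "sigma T s \<le> t" using sigma_le[OF T tT] by simp
      then show ?thesis using s sigma_ge[OF T, of s] by (auto simp: dist_real_def)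
    qed
    then show "\<forall>\<^sub>F s in at t within kappa T. dist (sigma T s) t < e"
      using d(1) e by (auto simp: eventually_at intro!: exI[of _ "min d e"])
  qed
  show ?thesis unfolding rd_continuous_def continuous_within
  proof (intro ballI conjI impI)
    fix t assume t: "t \<in> kappa T"
    then have tT: "t \<in> T" using kappa_subset by blast
    show "((\<lambda>t. f (sigma T t)) \<longlongrightarrow> f (sigma T t)) (at t within kappa T)" if "sigma T t = t"
      using f'[OF kappa_subset tT right[OF t that]] that by simp
    show "\<exists>l. ((\<lambda>t. f (sigma T t)) \<longlongrightarrow> l) (at t within kappa T \<inter> {..<t})"
      using f'[OF _ tT left[OF tT]] kappa_subset by blast
  qed
qed

lemma compact_kappa: assumes T: "time_scale T" shows "compact (kappa T)"
proof -
  have "kappa T = T \<inter> {..rho T (Sup T)}" by (auto simp: mem_kappa_iff[OF T])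
  then show ?thesis using time_scale_compact[OF T] by (simp add: compact_Int_closed)
qed

text \<open>
  Every point of the compact set \<open>kappa T\<close> has a neighbourhood that consists of the point, a left and
  a right part. A part on whose side the point is scattered can be taken empty; for the others the
  hypotheses provide a constant. Finitely many constants therefore suffice.
\<close>
lemma kappa_uniform_bound:
  assumes T: "time_scale T"
    and mono: "\<And>c c' t. R c t \<Longrightarrow> 0 < c' \<Longrightarrow> c' \<le> c \<Longrightarrow> R c' t"
    and point: "\<And>t. t \<in> kappa T \<Longrightarrow> \<exists>c>0::real. R c t"
    and right: "\<And>t. t \<in> kappa T \<Longrightarrow> sigma T t = t \<Longrightarrow>
      \<exists>c>0. \<forall>\<^sub>F s in at t within kappa T. R c s"
    and left: "\<And>t. t \<in> kappa T \<Longrightarrow> rho T t = t \<Longrightarrow>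
      \<exists>c>0. \<forall>\<^sub>F s in at t within (kappa T \<inter> {..<t}). R c s"
  shows "\<exists>c>0. \<forall>t\<in>kappa T. R c t"
proof -
  define Q where "Q A \<longleftrightarrow> (\<exists>c>0. \<forall>t\<in>A. R c t)" for A
  have Q_un: "Q (A \<union> B)" if AB: "Q A" "Q B" for A B
  proof -
    obtain c c' where "c > 0" "c' > 0" "\<forall>t\<in>A. R c t" "\<forall>t\<in>B. R c' t"
      using AB by (auto simp: Q_def)
    then show ?thesis unfolding Q_def using mono[of _ _ "min c c'"]
      by (intro exI[of _ "min c c'"]) auto
  qed
  have Q_sub: "Q A" if "Q B" "A \<subseteq> B" for A B using that by (auto simp: Q_def)
  have Q_empty: "Q {}" by (auto simp: Q_def intro: exI[of _ 1])
  have local: "\<exists>d>0. Q (kappa T \<inter> ball t d)" if t: "t \<in> kappa T" for t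
  proof -
    have tT: "t \<in> T" using t kappa_subset by blast
    have l: "\<exists>d>0. Q (kappa T \<inter> {t - d<..<t})"
    proof (cases "rho T t = t")
      case True
      then obtain c d where "c > 0" "d > 0" "\<forall>s\<in>kappa T \<inter> {..<t}. s \<noteq> t \<and> dist s t < d \<longrightarrow> R c s"
        using left[OF t] unfolding eventually_at by blast
      then show ?thesis unfolding Q_def by (intro exI[of _ d]) (auto simp: dist_real_def)
    next
      case False
      then have "rho T t < t" using rho_le[OF T, of t] by simp
      moreover have "kappa T \<inter> {t - (t - rho T t)<..<t} = {}"
        using rho_ge[OF T, of _ t] kappa_subset by fastforce
      ultimately show ?thesis using Q_empty by (metis diff_gt_0_iff_gt)
    qed
    have r: "\<exists>d>0. Q (kappa T \<inter> {t<..<t + d})"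
    proof (cases "sigma T t = t")
      case True
      then obtain c d where "c > 0" "d > 0" "\<forall>s\<in>kappa T. s \<noteq> t \<and> dist s t < d \<longrightarrow> R c s"
        using right[OF t] unfolding eventually_at by blast
      then show ?thesis unfolding Q_def by (intro exI[of _ d]) (auto simp: dist_real_def)
    next
      case False
      then have "t < sigma T t" using sigma_ge[OF T, of t] by simp
      moreover have "kappa T \<inter> {t<..<t + (sigma T t - t)} = {}"
        using sigma_le[OF T, of _ t] kappa_subset by fastforce
      ultimately show ?thesis using Q_empty by (metis diff_gt_0_iff_gt)
    qed
    obtain d d' where d: "d > 0" "Q (kappa T \<inter> {t - d<..<t})" "d' > 0" "Q (kappa T \<inter> {t<..<t + d'})"
      using l r by blast
    have "Q {t}" using point[OF t] by (auto simp: Q_def)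
    then have "Q (kappa T \<inter> {t - d<..<t} \<union> (kappa T \<inter> {t<..<t + d'} \<union> {t}))" using d by (intro Q_un)
    then have "Q (kappa T \<inter> ball t (min d d'))"
      by (rule Q_sub) (auto simp: dist_real_def abs_less_iff)
    then show ?thesis using d by (intro exI[of _ "min d d'"]) auto
  qed
  then obtain d where d: "\<And>t. t \<in> kappa T \<Longrightarrow> d t > 0 \<and> Q (kappa T \<inter> ball t (d t))" by metis
  obtain C where C: "C \<subseteq> kappa T" "finite C" "kappa T \<subseteq> (\<Union>t\<in>C. ball t (d t))"
    by (rule compactE_image[OF compact_kappa[OF T], of "kappa T" "\<lambda>t. ball t (d t)"]) (use d in auto)
  have "Q (kappa T \<inter> (\<Union>t\<in>C. ball t (d t)))"
    using C(2,1)
  proof (induction C)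
    case (insert t C)
    then show ?case using Q_un[of "kappa T \<inter> ball t (d t)"] d by (simp add: Int_Un_distrib)
  qed (simp add: Q_empty)
  then have "Q (kappa T)" using Q_sub C(3) by blast
  then show ?thesis by (simp add: Q_def)
qed

lemma rd_continuous_bounded:
  fixes f :: "real \<Rightarrow> 'a::real_normed_vector"
  assumes T: "time_scale T" and f: "rd_continuous T f"
  shows "\<exists>M>0. \<forall>t\<in>kappa T. norm (f t) \<le> M"
proof -
  have ev: "\<exists>c>0. \<forall>\<^sub>F s in F. norm (f s) * c \<le> 1" if "(f \<longlongrightarrow> l) F" for l F
  proof -
    have "((\<lambda>s. norm (f s)) \<longlongrightarrow> norm l) F" using that by (rule tendsto_norm)
    then have "\<forall>\<^sub>F s in F. norm (f s) < norm l + 1" by (rule order_tendstoD) simp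
    then have "\<forall>\<^sub>F s in F. norm (f s) * (1 / (norm l + 1)) \<le> 1"
      by eventually_elim (simp add: field_simps add_pos_nonneg)
    then show ?thesis by (intro exI[of _ "1 / (norm l + 1)"]) (simp add: add_nonneg_pos)
  qed
  have "\<exists>c>0. \<forall>t\<in>kappa T. norm (f t) * c \<le> 1"
  proof (rule kappa_uniform_bound[OF T])
    fix c c' t assume "norm (f t) * c \<le> 1" "0 < c'" "c' \<le> (c::real)"
    then show "norm (f t) * c' \<le> 1" using mult_left_mono[of c' c "norm (f t)"] by simp
  next
    fix t
    show "\<exists>c>0. norm (f t) * c \<le> 1"
      using add_nonneg_pos[OF norm_ge_zero[of "f t"] zero_less_one]
      by (intro exI[of _ "1 / (norm (f t) + 1)"]) (simp add: field_simps)
  qed (use ev rd_continuous_left[OF f] rd_continuous_right[OF f] in blast)+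
  then obtain c where "c > 0" "\<forall>t\<in>kappa T. norm (f t) * c \<le> 1" by blast
  then show ?thesis by (intro exI[of _ "1 / c"]) (auto simp: field_simps)
qed

lemma rd_continuous_param_compose:
  assumes g: "rd_continuous_param T g" and w: "rd_continuous T w"
  shows "rd_continuous T (\<lambda>t. g t (w t))"
proof -
  have lim: "((\<lambda>s. g s (w s)) \<longlongrightarrow> l) (at t within A)"
    if "((\<lambda>(s, v). g s v) \<longlongrightarrow> l) (at (t, u) within (A \<times> UNIV))" "(w \<longlongrightarrow> u) (at t within A)" for t u l A
  proof -
    have "filterlim (\<lambda>s. (s, w s)) (at (t, u) within (A \<times> UNIV)) (at t within A)"
      unfolding filterlim_at using that(2)
      by (auto simp: eventually_at_filter intro!: tendsto_Pair)
    from filterlim_compose[OF that(1) this] show ?thesis by simp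
  qed
  show ?thesis unfolding rd_continuous_def continuous_within
  proof (intro ballI conjI impI)
    fix t assume t: "t \<in> kappa T"
    show "((\<lambda>t. g t (w t)) \<longlongrightarrow> g t (w t)) (at t within kappa T)" if "sigma T t = t"
      using g t that rd_continuous_right[OF w t that]
      by (intro lim) (auto simp: rd_continuous_param_def continuous_within)
    show "\<exists>l. ((\<lambda>t. g t (w t)) \<longlongrightarrow> l) (at t within kappa T \<inter> {..<t})" if "rho T t = t"
      using g t that rd_continuous_left[OF w t that] lim
      unfolding rd_continuous_param_def by blast
  qed
qed

text \<open>
  This replaces uniform continuity on a tube around the graph of \<open>w\<close>. Near a left-dense point the
  tube is compared with the left limit of \<open>w\<close>, which may differ from the value of \<open>w\<close> there. The
  continuity of each \<open>g t\<close> covers the points themselves.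
\<close>
lemma rd_continuous_param_uniform:
  fixes g :: "real \<Rightarrow> 'b::metric_space \<Rightarrow> 'a::metric_space"
  assumes T: "time_scale T" and g: "rd_continuous_param T g" and w: "rd_continuous T w"
    and cont: "\<And>t. t \<in> kappa T \<Longrightarrow> continuous_on UNIV (g t)" and e: "e > 0"
  shows "\<exists>d>0. \<forall>t\<in>kappa T. \<forall>v. dist v (w t) < d \<longrightarrow> dist (g t v) (g t (w t)) < e"
proof -
  have lim: "\<exists>d>0. \<forall>\<^sub>F s in at t within A. \<forall>v. dist v (w s) < d \<longrightarrow> dist (g s v) (g s (w s)) < e"
    if g: "((\<lambda>(s, v). g s v) \<longlongrightarrow> l) (at (t, u) within (A \<times> UNIV))"
      and w: "(w \<longlongrightarrow> u) (at t within A)" for t u l A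
  proof -
    have "\<forall>\<^sub>F p in at (t, u) within (A \<times> UNIV). dist (case p of (s, v) \<Rightarrow> g s v) l < e / 2"
      using e by (intro tendstoD[OF g]) simp
    then obtain d where d: "d > 0" "\<And>s v. s \<in> A \<Longrightarrow> s \<noteq> t \<Longrightarrow> dist (s, v) (t, u) < d \<Longrightarrow> dist (g s v) l < e / 2"
      unfolding eventually_at by fastforce
    have ev: "\<forall>\<^sub>F s in at t within A. dist (w s) u < d / 4" using d by (intro tendstoD[OF w]) simp
    have "\<forall>\<^sub>F s in at t within A. s \<in> A \<and> s \<noteq> t \<and> dist s t < d / 4"
      using d by (auto simp: eventually_at intro!: exI[of _ "d / 4"])
    with ev have "\<forall>\<^sub>F s in at t within A. \<forall>v. dist v (w s) < d / 4 \<longrightarrow> dist (g s v) (g s (w s)) < e"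
    proof eventually_elim
      case (elim s)
      have near: "dist (g s v) l < e / 2" if "dist v (w s) < d / 4" for v
      proof (rule d(2))
        have "dist (s, v) (t, u) \<le> dist s t + dist v u"
          by (simp add: dist_Pair_Pair sqrt_sum_squares_le_sum)
        also have "\<dots> < d"
          using d(1) elim(1) elim(2)[THEN conjunct2, THEN conjunct2] that dist_triangle[of v u "w s"]
          by linarith
        finally show "dist (s, v) (t, u) < d" .
      qed (use elim in auto)
      show ?case
      proof (intro allI impI)
        fix v assume v: "dist v (w s) < d / 4"
        show "dist (g s v) (g s (w s)) < e"
          using dist_triangle_half_l[OF near[OF v] near[of "w s"]] d(1) by simp
      qed
    qed
    then show ?thesis using d(1) by (intro exI[of _ "d / 4"]) auto
  qed
  show ?thesis
  proof (rule kappa_uniform_bound[OF T])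
    fix t assume t: "t \<in> kappa T"
    show "\<exists>d>0. \<forall>v. dist v (w t) < d \<longrightarrow> dist (g t v) (g t (w t)) < e"
      using cont[OF t] e unfolding continuous_on_iff by blast
    show "\<exists>d>0. \<forall>\<^sub>F s in at t within kappa T. \<forall>v. dist v (w s) < d \<longrightarrow> dist (g s v) (g s (w s)) < e"
      if "sigma T t = t"
      using g t that rd_continuous_right[OF w t that]
      by (intro lim) (auto simp: rd_continuous_param_def continuous_within)
    show "\<exists>d>0. \<forall>\<^sub>F s in at t within kappa T \<inter> {..<t}. \<forall>v. dist v (w s) < d \<longrightarrow> dist (g s v) (g s (w s)) < e"
      if "rho T t = t"
      using g t that rd_continuous_left[OF w t that] lim
      unfolding rd_continuous_param_def by blast
  qed force
qed


section \<open>Antiderivatives of rd-continuous functions\<close>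

text \<open>
  Near each point, one-sided limits allow an approximation within \<open>e\<close> by a function that is constant
  on each side. Bisection glues these into a uniform approximation by an integrable function.
\<close>
lemma regulated_integrable:
  fixes g :: "real \<Rightarrow> 'a::banach"
  assumes right: "\<And>x. a \<le> x \<Longrightarrow> x < b \<Longrightarrow> \<exists>l. (g \<longlongrightarrow> l) (at_right x)"
    and left: "\<And>x. a < x \<Longrightarrow> x \<le> b \<Longrightarrow> \<exists>l. (g \<longlongrightarrow> l) (at_left x)"
  shows "g integrable_on {a..b}"
proof (cases "a \<le> b")
  case True
  have "\<exists>h. (\<forall>x\<in>cbox a b. norm (g x - h x) \<le> e) \<and> h integrable_on cbox a b" if e: "e > 0" for e
  proof -
    define P where "P c d \<longleftrightarrow> (a \<le> c \<and> d \<le> b \<longrightarrow>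
      (\<exists>h. (\<forall>x\<in>{c..d}. norm (g x - h x) \<le> e) \<and> h integrable_on {c..d}))" for c d
    have tr: "P c d" if cd: "P c m" "P m d" "c \<le> m" "m \<le> d" for c m d
      unfolding P_def
    proof
      assume "a \<le> c \<and> d \<le> b"
      then obtain h h' where h: "\<forall>x\<in>{c..m}. norm (g x - h x) \<le> e" "h integrable_on {c..m}"
        and h': "\<forall>x\<in>{m..d}. norm (g x - h' x) \<le> e" "h' integrable_on {m..d}"
        using cd unfolding P_def by fastforce
      let ?k = "\<lambda>x. if x \<le> m then h x else h' x"
      have "?k integrable_on {c..m}" using h(2) by (rule integrable_eq) auto
      moreover have "?k integrable_on {m..d}"
        by (rule integrable_spike_finite[of "{m}" _ _ h']) (use h' in auto)
      ultimately have "?k integrable_on {c..d}" 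
        using Henstock_Kurzweil_Integration.integrable_combine[OF cd(3,4)] by blast
      then show "\<exists>h. (\<forall>x\<in>{c..d}. norm (g x - h x) \<le> e) \<and> h integrable_on {c..d}"
        using h h' by (intro exI[of _ ?k]) auto
    qed
    have step: "\<exists>h. (\<forall>x\<in>{c..d}. norm (g x - h x) \<le> e) \<and> h integrable_on {c..d}"
      if "\<And>y. c \<le> y \<Longrightarrow> y \<le> d \<Longrightarrow> y \<noteq> x \<Longrightarrow> norm (g y - l) \<le> e" for c d x l
    proof (intro exI conjI)
      show "(\<lambda>y. if y = x then g x else l) integrable_on {c..d}"
        by (rule integrable_spike_finite[of "{x}" _ _ "\<lambda>_. l"]) (auto intro: integrable_const_ivl)
      show "\<forall>y\<in>{c..d}. norm (g y - (if y = x then g x else l)) \<le> e" using that e by auto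
    qed
    have "P a b"
    proof (rule Bolzano[OF True tr])
      fix x assume x: "a \<le> x" "x \<le> b"
      have "\<exists>d>0. \<forall>c. c \<le> x \<and> x - c < d \<longrightarrow> P c x"
      proof (cases "a < x")
        case True
        then obtain l where "(g \<longlongrightarrow> l) (at_left x)" using left x by blast
        then have "\<forall>\<^sub>F y in at_left x. dist (g y) l < e" using e by (rule tendstoD)
        then obtain d where d: "d > 0" "\<And>y. y < x \<Longrightarrow> x - d < y \<Longrightarrow> norm (g y - l) < e"
          unfolding eventually_at by (auto simp: dist_real_def dist_norm abs_if)
        show ?thesis unfolding P_def
          by (rule exI[of _ d]) (use d in \<open>auto intro!: step[where x=x and l=l] less_imp_le\<close>)
      next
        case False
        then show ?thesis unfolding P_def
          by (intro exI[of _ 1]) (auto intro!: step[where x=x])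
      qed
      moreover have "\<exists>d>0. \<forall>c. x \<le> c \<and> c - x < d \<longrightarrow> P x c"
      proof (cases "x < b")
        case True
        then obtain l where "(g \<longlongrightarrow> l) (at_right x)" using right x by blast
        then have "\<forall>\<^sub>F y in at_right x. dist (g y) l < e" using e by (rule tendstoD)
        then obtain d where d: "d > 0" "\<And>y. x < y \<Longrightarrow> y < x + d \<Longrightarrow> norm (g y - l) < e"
          unfolding eventually_at by (auto simp: dist_real_def dist_norm abs_if)
        show ?thesis unfolding P_def
          by (rule exI[of _ d]) (use d in \<open>auto intro!: step[where x=x and l=l] less_imp_le\<close>)
      next
        case False
        then show ?thesis unfolding P_def
          by (intro exI[of _ 1]) (auto intro!: step[where x=x])
      qed
      ultimately obtain d d' where dd: "d > 0" "d' > 0"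
        "\<And>c. c \<le> x \<Longrightarrow> x - c < d \<Longrightarrow> P c x" "\<And>c. x \<le> c \<Longrightarrow> c - x < d' \<Longrightarrow> P x c" by blast
      show "\<exists>d>0. \<forall>c c'. c \<le> x \<and> x \<le> c' \<and> c' - c < d \<longrightarrow> P c c'"
      proof (intro exI conjI allI impI)
        fix c c' assume c: "c \<le> x \<and> x \<le> c' \<and> c' - c < min d d'"
        show "P c c'" by (rule tr[OF dd(3) dd(4)]) (use c in auto)
      qed (use dd in auto)
    qed
    then show ?thesis by (simp add: P_def)
  qed
  then show ?thesis using integrable_uniform_limit[of a b g] by simp
qed (simp add: integrable_on_empty)

text \<open>
  The step extension of \<open>f\<close> takes at \<open>x\<close> the value of \<open>f\<close> at the last point of \<open>T\<close> not after \<open>x\<close>.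
  On a gap \<open>[t, \<sigma>(t))\<close> it is therefore constant \<open>f t\<close>, so that its integral over the gap is exactly
  \<open>(\<sigma>(t) - t) f(t)\<close>.
\<close>
lemma step_extension_point:
  assumes T: "time_scale T" and x: "Inf T \<le> x"
  shows "Sup {t\<in>T. t \<le> x} \<in> T" "Sup {t\<in>T. t \<le> x} \<le> x"
    and "s \<in> T \<Longrightarrow> s \<le> x \<Longrightarrow> s \<le> Sup {t\<in>T. t \<le> x}"
proof -
  have ne: "{t\<in>T. t \<le> x} \<noteq> {}" using Inf_in[OF T] x by blast
  have bdd: "bdd_above {t\<in>T. t \<le> x}" by (auto intro!: bdd_aboveI[of _ x])
  have "closed (T \<inter> {..x})" using time_scale_closed[OF T] by blast
  also have "T \<inter> {..x} = {t\<in>T. t \<le> x}" by auto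
  finally have "Sup {t\<in>T. t \<le> x} \<in> {t\<in>T. t \<le> x}"
    using closed_contains_Sup[OF ne bdd] by blast
  then show "Sup {t\<in>T. t \<le> x} \<in> T" "Sup {t\<in>T. t \<le> x} \<le> x" by auto
  show "s \<le> Sup {t\<in>T. t \<le> x}" if "s \<in> T" "s \<le> x" using that bdd by (simp add: cSup_upper)
qed

lemma step_extension_integrable:
  fixes f :: "real \<Rightarrow> 'a::banach"
  assumes T: "time_scale T" and f: "rd_continuous T f"
  shows "(\<lambda>x. f (Sup {t\<in>T. t \<le> x})) integrable_on {Inf T..Sup T}"
proof (rule regulated_integrable)
  let ?p = "\<lambda>x. Sup {t\<in>T. t \<le> x}"
  note p = step_extension_point[OF T]
  fix x assume x: "Inf T \<le> x" "x < Sup T"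
  show "\<exists>l. ((\<lambda>x. f (?p x)) \<longlongrightarrow> l) (at_right x)"
  proof (cases "x \<in> T \<and> sigma T x = x")
    case True
    then have xk: "x \<in> kappa T" using less_Sup_in_kappa[OF T] x by blast
    have "((\<lambda>x. f (?p x)) \<longlongrightarrow> f x) (at_right x)"
    proof (rule tendstoI)
      fix e :: real assume e: "e > 0"
      obtain d where d: "d > 0" "\<forall>s\<in>kappa T. s \<noteq> x \<and> dist s x < d \<longrightarrow> dist (f s) (f x) < e"
        using tendstoD[OF rd_continuous_right[OF f xk] e] True unfolding eventually_at by blast
      have "dist (f (?p y)) (f x) < e" if y: "x < y" "y < x + min d (Sup T - x)" for y
      proof -
        have "?p y \<in> T" "?p y \<le> y" "x \<le> ?p y" using p[of y] x y True by auto
        then have "?p y \<in> kappa T" "dist (?p y) x < d"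
          using less_Sup_in_kappa[OF T, of "?p y"] y by (auto simp: dist_real_def)
        then show ?thesis using d e by (cases "?p y = x") auto
      qed
      then show "\<forall>\<^sub>F y in at_right x. dist (f (?p y)) (f x) < e"
        unfolding eventually_at using d(1) x
        by (intro exI[of _ "min d (Sup T - x)"]) (auto simp: dist_real_def)
    qed
    then show ?thesis by blast
  next
    case False
    have "\<exists>d>0. \<forall>t\<in>T. \<not> (x < t \<and> t < x + d)"
    proof (cases "x \<in> T")
      case True
      then have "x < sigma T x" using False sigma_ge[OF T, of x] by simp
      then show ?thesis using sigma_le[OF T, of _ x]
        by (intro exI[of _ "sigma T x - x"]) fastforce
    next
      case False
      then obtain d where "d > 0" "ball x d \<subseteq> - T"
        using time_scale_closed[OF T] open_contains_ball[of "- T"] by (auto simp: open_Compl)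
      then show ?thesis by (intro exI[of _ d]) (auto simp: subset_eq dist_real_def)
    qed
    then obtain d where d: "d > 0" "\<forall>t\<in>T. \<not> (x < t \<and> t < x + d)" by blast
    have eq: "{t\<in>T. t \<le> y} = {t\<in>T. t \<le> x}" if "x < y" "y < x + d" for y
      using d(2) that by force
    have "\<forall>\<^sub>F y in at_right x. f (?p x) = f (?p y)"
      unfolding eventually_at using d(1)
      by (intro exI[of _ d]) (use eq in \<open>auto simp: dist_real_def\<close>)
    then have "((\<lambda>y. f (?p y)) \<longlongrightarrow> f (?p x)) (at_right x)"
      by (rule tendsto_cong[THEN iffD1]) simp
    then show ?thesis by blast
  qed
next
  let ?p = "\<lambda>x. Sup {t\<in>T. t \<le> x}"
  note p = step_extension_point[OF T]
  fix x assume x: "Inf T < x" "x \<le> Sup T"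
  show "\<exists>l. ((\<lambda>x. f (?p x)) \<longlongrightarrow> l) (at_left x)"
  proof (cases "x \<in> T \<and> rho T x = x")
    case True
    then have xk: "x \<in> kappa T" using left_dense_in_kappa[OF T] by blast
    obtain l where l: "(f \<longlongrightarrow> l) (at x within (kappa T \<inter> {..<x}))"
      using rd_continuous_left[OF f xk] True by blast
    have "((\<lambda>x. f (?p x)) \<longlongrightarrow> l) (at_left x)"
    proof (rule tendstoI)
      fix e :: real assume e: "e > 0"
      obtain d where d: "d > 0" "\<forall>s\<in>kappa T \<inter> {..<x}. s \<noteq> x \<and> dist s x < d \<longrightarrow> dist (f s) l < e"
        using tendstoD[OF l e] unfolding eventually_at by blast
      obtain v where v: "v \<in> T" "x - d < v" "v < x"
        using rho_less_approx[OF T Inf_in[OF T] x(1) _ d(1)] True by blast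
      have "dist (f (?p y)) l < e" if y: "v < y" "y < x" for y
      proof -
        have "?p y \<in> T" "?p y \<le> y" "v \<le> ?p y" using p[of y] Inf_le[OF T v(1)] y v by auto
        then have "?p y \<in> kappa T" "?p y < x" "dist (?p y) x < d"
          using less_Sup_in_kappa[OF T, of "?p y"] y v x by (auto simp: dist_real_def)
        then show ?thesis using d by auto
      qed
      then show "\<forall>\<^sub>F y in at_left x. dist (f (?p y)) l < e"
        unfolding eventually_at using v
        by (intro exI[of _ "x - v"]) (auto simp: dist_real_def)
    qed
    then show ?thesis by blast
  next
    case False
    have "\<exists>d>0. \<forall>t\<in>T. \<not> (x - d < t \<and> t < x)"
    proof (cases "x \<in> T")
      case True
      then have "rho T x < x" using False rho_le[OF T, of x] by simp
      then show ?thesis using rho_ge[OF T, of _ x]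
        by (intro exI[of _ "x - rho T x"]) fastforce
    next
      case False
      then obtain d where "d > 0" "ball x d \<subseteq> - T"
        using time_scale_closed[OF T] open_contains_ball[of "- T"] by (auto simp: open_Compl)
      then show ?thesis by (intro exI[of _ d]) (auto simp: subset_eq dist_real_def)
    qed
    then obtain d where d: "d > 0" "\<forall>t\<in>T. \<not> (x - d < t \<and> t < x)" by blast
    have eq: "{t\<in>T. t \<le> y} = {t\<in>T. t \<le> x - d}" if "y < x" "x - d < y" for y
      using d that by force
    have "\<forall>\<^sub>F y in at_left x. f (?p (x - d)) = f (?p y)"
      unfolding eventually_at using d(1)
      by (intro exI[of _ d]) (use eq in \<open>auto simp: dist_real_def\<close>)
    then have "((\<lambda>y. f (?p y)) \<longlongrightarrow> f (?p (x - d))) (at_left x)"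
      by (rule tendsto_cong[THEN iffD1]) simp
    then show ?thesis by blast
  qed
qed

text \<open>
  The integral of the step extension over \<open>[s, u]\<close>, for \<open>s, u \<in> T\<close>, involves only values \<open>f \<tau>\<close> with
  \<open>\<tau> \<in> T\<close> and \<open>s \<le> \<tau> < u\<close>. Such \<open>\<tau>\<close> lie in \<open>kappa T\<close>, so only values controlled by rd-continuity enter.
\<close>
theorem rd_continuous_antiderivative:
  fixes f :: "real \<Rightarrow> 'a::banach"
  assumes T: "time_scale T" and f: "rd_continuous T f"
  shows "\<exists>F. \<forall>t\<in>kappa T. has_delta_derivative T F (f t) t"
proof -
  let ?g = "\<lambda>x. f (Sup {t\<in>T. t \<le> x})"
  define F where "F t = integral {Inf T..t} ?g" for t
  have est: "norm (F u - F s - (u - s) *\<^sub>R c) \<le> e * (u - s)"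
    if "s \<in> T" "u \<in> T" "s \<le> u" and "e \<ge> 0"
      and close: "\<And>\<tau>. \<tau> \<in> T \<Longrightarrow> s \<le> \<tau> \<Longrightarrow> \<tau> < u \<Longrightarrow> norm (f \<tau> - c) \<le> e" for s u c e
  proof -
    have su: "Inf T \<le> s" "u \<le> Sup T" using that Inf_le[OF T] le_Sup[OF T] by auto
    note int = integrable_subinterval_real[OF step_extension_integrable[OF T f]]
    have i: "?g integrable_on {Inf T..u}" "?g integrable_on {s..u}"
      using su that by (auto intro!: int)
    have "F u - F s = integral {s..u} ?g"
      unfolding F_def using Henstock_Kurzweil_Integration.integral_combine[OF su(1) that(3) i(1)]
      by (simp add: algebra_simps)
    then have hi: "((\<lambda>x. ?g x - c) has_integral (F u - F s - (u - s) *\<^sub>R c)) (cbox s u)"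
      using i(2) has_integral_const_real[of c s u] that(3)
      by (auto intro!: has_integral_diff simp: integrable_integral)
    have "norm (F u - F s - (u - s) *\<^sub>R c) \<le> e * measure lborel (cbox s u)"
    proof (rule has_integral_bound_spike_finite[OF \<open>e \<ge> 0\<close> _ hi, of "{u}"])
      fix x assume x: "x \<in> cbox s u - {u}"
      then have "Inf T \<le> x" using su by auto
      from step_extension_point[OF T this] show "norm (?g x - c) \<le> e"
        using x that(1) by (intro close) force+
    qed simp
    then show ?thesis using that(3) by simp
  qed
  obtain M where M: "M > 0" "\<And>t. t \<in> kappa T \<Longrightarrow> norm (f t) \<le> M"
    using rd_continuous_bounded[OF T f] by blast
  \<comment> \<open>The estimate with \<open>c = 0\<close> makes \<open>F\<close> Lipschitz, which gives continuity at right-scattered points.\<close>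
  have lip: "norm (F u - F s) \<le> M * \<bar>u - s\<bar>" if "s \<in> T" "u \<in> T" for s u
  proof -
    have *: "norm (F u - F s) \<le> M * (u - s)" if "s \<in> T" "u \<in> T" "s \<le> u" for s u
      using est[OF that, of M 0] M le_Sup[OF T] less_Sup_in_kappa[OF T] that by fastforce
    show ?thesis using *[OF that] *[OF that(2,1)] by (cases "s \<le> u") (auto simp: norm_minus_commute)
  qed
  have cont: "continuous (at t within T) F" if t: "t \<in> T" for t
  proof -
    have "((\<lambda>s. F s - F t) \<longlongrightarrow> 0) (at t within T)"
    proof (rule Lim_null_comparison)
      show "\<forall>\<^sub>F s in at t within T. norm (F s - F t) \<le> M * \<bar>s - t\<bar>"
        using lip[OF t] by (auto simp: eventually_at_filter)
      have "((\<lambda>s. M * \<bar>s - t\<bar>) \<longlongrightarrow> M * \<bar>t - t\<bar>) (at t within T)" by (intro tendsto_intros)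
      then show "((\<lambda>s. M * \<bar>s - t\<bar>) \<longlongrightarrow> 0) (at t within T)" by simp
    qed
    then show ?thesis by (simp add: continuous_within LIM_zero_iff)
  qed
  have "has_delta_derivative T F (f t) t" if tk: "t \<in> kappa T" for t
  proof -
    have t: "t \<in> T" using tk kappa_subset by blast
    show ?thesis
    proof (cases "sigma T t = t")
      case False
      then have st: "t < sigma T t" using sigma_ge[OF T, of t] by simp
      have "norm (F (sigma T t) - F t - (sigma T t - t) *\<^sub>R f t) \<le> 0 * (sigma T t - t)"
      proof (rule est[OF t sigma_in[OF T t]])
        fix v assume "v \<in> T" "t \<le> v" "v < sigma T t"
        then have "v = t" using sigma_le[OF T, of v t] by force
        then show "norm (f v - f t) \<le> 0" by simp
      qed (use st in auto)
      then show ?thesis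
        using cont[OF t] by (simp add: has_delta_derivative_scattered[OF t st] algebra_simps)
    next
      case True
      show ?thesis unfolding has_delta_derivative_def True
      proof (intro allI impI)
        fix e :: real assume e: "e > 0"
        obtain d where d: "d > 0" "\<And>v. v \<in> kappa T \<Longrightarrow> v \<noteq> t \<Longrightarrow> dist v t < d \<Longrightarrow> dist (f v) (f t) < e"
          using tendstoD[OF rd_continuous_right[OF f tk True] e] unfolding eventually_at by blast
        have close: "norm (f v - f t) \<le> e" if "v \<in> T" "v < Sup T" "\<bar>v - t\<bar> < d" for v
          using d(2)[of v] that less_Sup_in_kappa[OF T] e
          by (cases "v = t") (auto simp: dist_norm intro: less_imp_le)
        have "norm (F t - F s - (t - s) *\<^sub>R f t) \<le> e * \<bar>t - s\<bar>"
          if s: "s \<in> T" "t - d < s" "s < t + d" for s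
        proof (cases "s \<le> t")
          case True
          have "norm (F t - F s - (t - s) *\<^sub>R f t) \<le> e * (t - s)"
            using s True t e le_Sup[OF T t] by (intro est close) auto
          then show ?thesis using True by simp
        next
          case False
          have "norm (F s - F t - (s - t) *\<^sub>R f t) \<le> e * (s - t)"
            using s False t e le_Sup[OF T s(1)] by (intro est close) auto
          moreover have "F t - F s - (t - s) *\<^sub>R f t = - (F s - F t - (s - t) *\<^sub>R f t)"
            by (simp add: algebra_simps)
          ultimately show ?thesis using False by (simp only: norm_minus_cancel) simp
        qed
        then show "\<exists>\<delta>>0. \<forall>s\<in>T \<inter> {t - \<delta><..<t + \<delta>}.
            norm (F t - F s - (t - s) *\<^sub>R f t) \<le> e * \<bar>t - s\<bar>"
          using d(1) by auto
      qed
    qed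
  qed
  then show ?thesis by blast
qed

lemma has_delta_derivative_integral:
  fixes f :: "real \<Rightarrow> 'a::{banach,real_inner}"
  assumes T: "time_scale T" and f: "rd_continuous T f" and t: "t \<in> kappa T"
  shows "has_delta_derivative T (\<lambda>t. delta_integral T f (Inf T) t) (f t) t"
proof -
  obtain F where F: "\<And>t. t \<in> kappa T \<Longrightarrow> has_delta_derivative T F (f t) t"
    using rd_continuous_antiderivative[OF T f] by blast
  have tT: "t \<in> T" using t kappa_subset by blast
  have "has_delta_derivative T (\<lambda>t. F t - F (Inf T)) (f t - 0) t"
    by (rule has_delta_derivative_diff[OF T tT F[OF t] has_delta_derivative_const])
  then have "has_delta_derivative T (\<lambda>t. F t - F (Inf T)) (f t) t" by simp
  then show ?thesis
    by (subst has_delta_derivative_cong[OF T tT, where g = "\<lambda>t. F t - F (Inf T)"])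
      (simp_all add: delta_integral_eq[OF T F Inf_in[OF T]])
qed

lemma delta_integral_lincomb:
  fixes f g :: "real \<Rightarrow> 'a::{banach,real_inner}"
  assumes T: "time_scale T" and f: "rd_continuous T f" and g: "rd_continuous T g"
    and "s \<in> T" "u \<in> T"
  shows "delta_integral T (\<lambda>t. f t + c *\<^sub>R g t) s u = delta_integral T f s u + c *\<^sub>R delta_integral T g s u"
proof -
  obtain F G where F: "\<And>t. t \<in> kappa T \<Longrightarrow> has_delta_derivative T F (f t) t"
    and G: "\<And>t. t \<in> kappa T \<Longrightarrow> has_delta_derivative T G (g t) t"
    using rd_continuous_antiderivative[OF T f] rd_continuous_antiderivative[OF T g] by blast
  have FG: "has_delta_derivative T (\<lambda>t. F t + c *\<^sub>R G t) (f t + c *\<^sub>R g t) t" if "t \<in> kappa T" for t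
    using that kappa_subset[of T]
    by (intro has_delta_derivative_add[OF T] has_delta_derivative_scaleR[OF T] F G) auto
  note int = delta_integral_eq[OF T _ assms(4,5)]
  have "delta_integral T (\<lambda>t. f t + c *\<^sub>R g t) s u = (F u + c *\<^sub>R G u) - (F s + c *\<^sub>R G s)"
    by (rule int) (rule FG)
  moreover have "delta_integral T f s u = F u - F s" by (rule int) (rule F)
  moreover have "delta_integral T g s u = G u - G s" by (rule int) (rule G)
  ultimately show ?thesis by (simp only:) (simp add: algebra_simps)
qed

text \<open>
  An antiderivative of \<open>q \<bullet> q\<close> is nondecreasing and has equal end values, so it is
  constant, and uniqueness of the delta derivative gives \<open>q \<bullet> q = 0\<close> at each point.
\<close>
lemma delta_integral_inner_self_eq_0:
  fixes q :: "real \<Rightarrow> 'a::real_inner"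
  assumes T: "time_scale T" and q: "rd_continuous T q"
    and zero: "delta_integral T (\<lambda>t. q t \<bullet> q t) (Inf T) (Sup T) = 0" and t: "t \<in> kappa T"
  shows "q t = 0"
proof -
  obtain F where F: "\<And>t. t \<in> kappa T \<Longrightarrow> has_delta_derivative T F (q t \<bullet> q t) t"
    using rd_continuous_antiderivative[OF T rd_continuous_inner[OF q q]] by blast
  have cF: "continuous_on T F" by (rule has_delta_derivative_imp_continuous_on[OF T F])
  have ends: "F (Sup T) = F (Inf T)"
    using zero delta_integral_eq[OF T F Inf_in[OF T] Sup_in[OF T]] by simp
  have D: "has_delta_derivative T F (q s \<bullet> q s) s \<and> q s \<bullet> q s \<ge> 0" if "s \<in> T" "s < Sup T" for s
    using F less_Sup_in_kappa[OF T that] by simp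
  have const: "F s = F (Inf T)" if s: "s \<in> T" for s
    using delta_mono[OF T cF D Inf_in[OF T] s Inf_le[OF T s]]
      delta_mono[OF T cF D s Sup_in[OF T] le_Sup[OF T s]] ends by simp
  have tT: "t \<in> T" using t kappa_subset by blast
  have "has_delta_derivative T F 0 t \<longleftrightarrow> has_delta_derivative T (\<lambda>_. F (Inf T)) 0 t"
    by (rule has_delta_derivative_cong[OF T tT const])
  then have "has_delta_derivative T F 0 t" by (simp only: has_delta_derivative_const)
  then have "q t \<bullet> q t = 0" using has_delta_derivative_unique[OF T t F[OF t]] by blast
  then show ?thesis by simp
qed

lemma delta_integral_cong:
  assumes "\<And>t. t \<in> kappa T \<Longrightarrow> f t = g t"
  shows "delta_integral T f c d = delta_integral T g c d"
  unfolding delta_integral_def using assms by (simp cong: ball_cong)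

text \<open>Both \<open>c t + F t\<close> and \<open>c t - F t\<close> have nonnegative derivatives.\<close>
lemma delta_antiderivative_bound:
  fixes F :: "real \<Rightarrow> real"
  assumes T: "time_scale T" and F: "\<And>t. t \<in> kappa T \<Longrightarrow> has_delta_derivative T F (f t) t"
    and f: "\<And>t. t \<in> kappa T \<Longrightarrow> \<bar>f t\<bar> \<le> c"
  shows "\<bar>F (Sup T) - F (Inf T)\<bar> \<le> c * (Sup T - Inf T)"
proof -
  have mono: "c * Inf T + k * F (Inf T) \<le> c * Sup T + k * F (Sup T)" if k: "\<bar>k\<bar> = 1" for k
  proof -
    define G where "G = (\<lambda>t. c *\<^sub>R t + k *\<^sub>R F t)"
    have G: "has_delta_derivative T G (c *\<^sub>R 1 + k *\<^sub>R f t) t" if "t \<in> kappa T" for t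
      unfolding G_def using that kappa_subset[of T] F
      by (intro has_delta_derivative_add has_delta_derivative_scaleR T has_delta_derivative_id) auto
    have "0 \<le> c *\<^sub>R 1 + k *\<^sub>R f t" if "t \<in> kappa T" for t
    proof -
      have "\<bar>k * f t\<bar> \<le> c" using f[OF that] k by (simp add: abs_mult)
      then show ?thesis by simp
    qed
    then have GD: "has_delta_derivative T G (c *\<^sub>R 1 + k *\<^sub>R f t) t \<and> 0 \<le> c *\<^sub>R 1 + k *\<^sub>R f t"
      if "t \<in> T" "t < Sup T" for t
      using G less_Sup_in_kappa[OF T that] by blast
    have "G (Inf T) \<le> G (Sup T)"
      using has_delta_derivative_imp_continuous_on[OF T G] GD Inf_in[OF T] Sup_in[OF T]
        less_imp_le[OF Inf_less_Sup[OF T]]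
      by (rule delta_mono[OF T])
    then show ?thesis by (simp add: G_def)
  qed
  show ?thesis using mono[of 1] mono[of "-1"] by (simp add: algebra_simps abs_le_iff)
qed


section \<open>Iterated removal of a left-scattered maximum\<close>

lemma kappa_Suc: "kappa ((kappa ^^ j) T) = (kappa ^^ Suc j) T"
  by simp

lemma kappa_funpow_antimono: "j \<le> k \<Longrightarrow> (kappa ^^ k) T \<subseteq> (kappa ^^ j) T"
proof (induction k rule: dec_induct)
  case (step k)
  then show ?case using kappa_subset[of "(kappa ^^ k) T"] by auto
qed simp

lemma Inf_in_kappa: "time_scale T \<Longrightarrow> Inf T \<in> kappa T"
  by (simp add: less_Sup_in_kappa Inf_in Inf_less_Sup)

lemma Inf_kappa:
  assumes "time_scale T" "time_scale (kappa T)"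
  shows "Inf (kappa T) = Inf T"
proof (rule antisym)
  show "Inf (kappa T) \<le> Inf T" using Inf_le[OF assms(2) Inf_in_kappa[OF assms(1)]] .
  show "Inf T \<le> Inf (kappa T)" using Inf_le[OF assms(1)] Inf_in[OF assms(2)] kappa_subset by blast
qed

lemma Sup_kappa:
  assumes "time_scale T" "time_scale (kappa T)"
  shows "Sup (kappa T) = rho T (Sup T)"
proof (rule antisym)
  show "Sup (kappa T) \<le> rho T (Sup T)"
    using Sup_in[OF assms(2)] by (simp add: mem_kappa_iff[OF assms(1)])
  have "rho T (Sup T) \<in> kappa T"
    by (simp add: mem_kappa_iff[OF assms(1)] rho_in Sup_in assms(1))
  then show "rho T (Sup T) \<le> Sup (kappa T)" by (rule le_Sup[OF assms(2)])
qed

lemma rho_kappa: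
  assumes T: "time_scale T" and t: "t \<in> kappa T"
  shows "rho (kappa T) t = rho T t"
proof -
  have "s \<in> kappa T \<longleftrightarrow> s \<in> T" if "s < t" for s
    using that t by (auto simp: mem_kappa_iff[OF T])
  then have "{s\<in>kappa T. s < t} = {s\<in>T. s < t}" "(\<exists>s\<in>kappa T. s < t) \<longleftrightarrow> (\<exists>s\<in>T. s < t)" by blast+
  then show ?thesis by (simp add: rho_def)
qed

text \<open>
  Restricting to \<open>kappa T\<close> changes the jump operator only at the new maximum, which may be
  right-scattered in \<open>T\<close> but is fixed by the jump operator of \<open>kappa T\<close>.
\<close>
lemma sigma_kappa:
  assumes T: "time_scale T" and K: "time_scale (kappa T)" and t: "t < Sup (kappa T)"
  shows "sigma (kappa T) t = sigma T t"
proof -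
  let ?K = "{s\<in>kappa T. t < s}" and ?S = "{s\<in>T. t < s}"
  have m: "Sup (kappa T) \<in> ?K" using Sup_in[OF K] t by simp
  have sub: "?K \<subseteq> ?S" using kappa_subset by blast
  have bdd: "bdd_below ?S" "bdd_below ?K" by (auto intro!: bdd_belowI[of _ t])
  have "Inf ?K = Inf ?S"
  proof (rule antisym)
    show "Inf ?S \<le> Inf ?K" using m sub bdd by (intro cInf_superset_mono) auto
    show "Inf ?K \<le> Inf ?S"
    proof (rule cInf_greatest)
      show "?S \<noteq> {}" using m sub by blast
      fix s assume s: "s \<in> ?S"
      show "Inf ?K \<le> s"
      proof (cases "s \<in> kappa T")
        case True
        then show ?thesis using s bdd by (intro cInf_lower) auto
      next
        case False
        then have "Sup (kappa T) \<le> s"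
          using s by (simp add: mem_kappa_iff[OF T] Sup_kappa[OF T K])
        then show ?thesis using cInf_lower[OF m bdd(2)] by linarith
      qed
    qed
  qed
  moreover have "\<exists>s\<in>kappa T. t < s" "\<exists>s\<in>T. t < s" using m sub by blast+
  ultimately show ?thesis by (simp add: sigma_def)
qed

lemma time_scale_iff_card: "time_scale T \<longleftrightarrow> compact T \<and> (infinite T \<or> card T \<ge> 2)"
proof -
  have "(\<exists>s\<in>T. \<exists>t\<in>T. s < t) \<longleftrightarrow> \<not> (\<forall>s\<in>T. \<forall>t\<in>T. s = t)"
    by (metis less_irrefl linorder_neqE_linordered_idom)
  also have "\<dots> \<longleftrightarrow> infinite T \<or> card T \<ge> 2"
  proof (cases "finite T")
    case True
    then show ?thesis using card_le_Suc0_iff_eq[OF True] by auto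
  next
    case False
    then obtain s where "s \<in> T" by fastforce
    moreover obtain t where "t \<in> T - {s}" using False by (metis finite.emptyI infinite_remove all_not_in_conv)
    ultimately show ?thesis using False by auto
  qed
  finally show ?thesis by (simp add: time_scale_def)
qed

lemma time_scale_kappa_funpow:
  assumes "compact T" "infinite T \<or> card T \<ge> k + 1" "j < k"
  shows "time_scale ((kappa ^^ j) T) \<and> (infinite ((kappa ^^ j) T) \<or> card ((kappa ^^ j) T) \<ge> k + 1 - j)"
  using assms(3)
proof (induction j)
  case 0
  then show ?case using assms by (auto simp: time_scale_iff_card)
next
  case (Suc j)
  let ?S = "(kappa ^^ j) T"
  have S: "time_scale ?S" and c: "infinite ?S \<or> card ?S \<ge> k + 1 - j" using Suc by auto
  have sub: "?S \<subseteq> insert (Sup ?S) (kappa ?S)"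
    using less_Sup_in_kappa[OF S] le_Sup[OF S] by fastforce
  have card: "infinite (kappa ?S) \<or> card (kappa ?S) \<ge> k + 1 - Suc j"
  proof (rule ccontr)
    assume "\<not> ?thesis"
    then have fin: "finite (kappa ?S)" and less: "card (kappa ?S) < k - j" by auto
    then have "finite ?S" using sub finite_subset by blast
    moreover have "card ?S \<le> card (insert (Sup ?S) (kappa ?S))" using sub fin by (simp add: card_mono)
    ultimately show False using c less fin card_insert_le_m1[of _ "kappa ?S"]
      by (auto simp: card_insert_if split: if_splits)
  qed
  moreover have "time_scale (kappa ?S)"
    using card Suc.prems compact_kappa[OF S] by (auto simp: time_scale_iff_card)
  ultimately show ?case by simp
qed

text \<open>
  If the maximum \<open>m\<close> of \<open>kappa T\<close> is right-scattered in \<open>T\<close> and left-dense, the derivative of \<open>F\<close> at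
  \<open>m\<close> is a difference quotient over the gap in \<open>T\<close> but a one-sided limit in \<open>kappa T\<close>. The two agree for
  continuous \<open>f\<close>: an antiderivative of \<open>f\<close> on \<open>kappa T\<close> differs from \<open>F\<close> by a constant, since below
  \<open>m\<close> the two notions of derivative coincide.
\<close>
lemma has_delta_derivative_kappa:
  fixes F :: "real \<Rightarrow> 'a::{banach,real_inner}"
  assumes T: "time_scale T" and K: "time_scale (kappa T)"
    and F: "\<And>t. t \<in> kappa T \<Longrightarrow> has_delta_derivative T F (f t) t"
    and f: "continuous_on (kappa T) f" and t: "t \<in> kappa (kappa T)"
  shows "has_delta_derivative (kappa T) F (f t) t"
proof -
  have "rd_continuous (kappa T) f"
    using continuous_on_subset[OF f kappa_subset] by (rule continuous_imp_rd_continuous)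
  then obtain G where G: "\<And>t. t \<in> kappa (kappa T) \<Longrightarrow> has_delta_derivative (kappa T) G (f t) t"
    using rd_continuous_antiderivative[OF K] by blast
  have cF: "continuous_on (kappa T) F"
    using has_delta_derivative_imp_continuous_on[OF T F] kappa_subset continuous_on_subset by blast
  have cG: "continuous_on (kappa T) G" by (rule has_delta_derivative_imp_continuous_on[OF K G])
  have below: "has_delta_derivative (kappa T) F (f s) s" if "s \<in> kappa T" "s < Sup (kappa T)" for s
    using F[OF that(1)] kappa_subset
    unfolding has_delta_derivative_def sigma_kappa[OF T K that(2)] by blast
  have tK: "t \<in> kappa T" using t kappa_subset by blast
  have eq: "F s = G s + (F t - G t)" if "s \<in> kappa T" for s
    using delta_antiderivative_unique[OF K cF cG, of f t s] that tK below G
      less_Sup_in_kappa[OF K] by (auto simp: algebra_simps)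
  have "has_delta_derivative (kappa T) (\<lambda>s. G s + (F t - G t)) (f t + 0) t"
    by (rule has_delta_derivative_add[OF K tK G[OF t] has_delta_derivative_const])
  then show ?thesis
    by (subst has_delta_derivative_cong[OF K tK eq]) simp_all
qed


section \<open>Functions with \<open>r\<close> delta derivatives\<close>

text \<open>
  The derivative of order \<open>Suc j\<close> is formed on \<open>T\<^sub>j\<close>, where it is unique only if \<open>T\<^sub>j\<close> has two points.
\<close>
locale iterated_time_scale =
  fixes T :: "real set" and r :: nat
  assumes r: "r \<ge> 1" and ts: "j < r \<Longrightarrow> time_scale ((kappa ^^ j) T)"
begin

text \<open>
  A chain lists a function and its delta derivatives of orders up to \<open>r\<close>. Statements on
  \<open>C_rd\<close> become statements on chains, in which the iterated definite descriptions of
  \<open>delta_deriv_n\<close> no longer occur.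
\<close>
definition derivative_chain :: "(nat \<Rightarrow> real \<Rightarrow> 'a::real_normed_vector) \<Rightarrow> bool" where
  "derivative_chain z \<longleftrightarrow>
    (\<forall>j<r. \<forall>t\<in>(kappa ^^ Suc j) T. has_delta_derivative ((kappa ^^ j) T) (z j) (z (Suc j) t) t) \<and>
    rd_continuous ((kappa ^^ (r - 1)) T) (z r)"

lemma kappa_last: "kappa ((kappa ^^ (r - 1)) T) = (kappa ^^ r) T"
  using r by (cases r) simp_all

lemma ts_last: "time_scale ((kappa ^^ (r - 1)) T)"
  using r ts by simp

lemma Inf_funpow: "j < r \<Longrightarrow> Inf ((kappa ^^ j) T) = Inf T"
proof (induction j)
  case (Suc j)
  then show ?case using Inf_kappa[OF ts[of j]] ts[of "Suc j"] by simp
qed simp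

lemma Sup_funpow: "j < r \<Longrightarrow> Sup ((kappa ^^ j) T) = (rho T ^^ j) (Sup T)"
proof (induction j)
  case (Suc j)
  have rho_eq: "t \<in> (kappa ^^ i) T \<Longrightarrow> rho ((kappa ^^ i) T) t = rho T t" if "i < r" for i t
    using that
  proof (induction i)
    case (Suc i)
    then show ?case using rho_kappa[OF ts[of i], of t] kappa_subset by auto
  qed simp
  show ?case
    using Suc Sup_kappa[OF ts[of j]] ts[of "Suc j"] rho_eq[of j] Sup_in[OF ts[of j]] by simp
qed simp

lemma derivative_chain_delta_deriv_n:
  assumes z: "derivative_chain z" and y: "\<And>t. t \<in> T \<Longrightarrow> y t = z 0 t"
    and "j \<le> r" "t \<in> (kappa ^^ j) T"
  shows "delta_deriv_n T j y t = z j t"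
  using assms(3,4)
proof (induction j arbitrary: t)
  case 0
  then show ?case by (simp add: y)
next
  case (Suc j)
  have tk: "t \<in> kappa ((kappa ^^ j) T)" using Suc.prems by simp
  then have "has_delta_derivative ((kappa ^^ j) T) (delta_deriv_n T j y) (z (Suc j) t) t"
    using z Suc kappa_subset
    by (subst has_delta_derivative_cong[OF ts, of j t _ "z j"]) (auto simp: derivative_chain_def)
  then show ?case using delta_deriv_eqI[OF ts tk] Suc.prems by simp
qed

lemma derivative_chain_in_C_rd:
  assumes z: "derivative_chain z" and y: "\<And>t. t \<in> T \<Longrightarrow> y t = z 0 t"
  shows "y \<in> C_rd T r"
proof -
  have "has_delta_derivative ((kappa ^^ j) T) (delta_deriv_n T j y) (z (Suc j) t) t"
    if "j < r" "t \<in> (kappa ^^ Suc j) T" for j t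
    using that z kappa_subset derivative_chain_delta_deriv_n[OF z y, of j]
    by (subst has_delta_derivative_cong[OF ts, of j t _ "z j"]) (auto simp: derivative_chain_def)
  moreover have "rd_continuous ((kappa ^^ (r - 1)) T) (delta_deriv_n T r y)"
    using z derivative_chain_delta_deriv_n[OF z y]
    by (subst rd_continuous_cong[of _ _ "z r"]) (auto simp: derivative_chain_def kappa_last simp del: One_nat_def)
  ultimately show ?thesis unfolding C_rd_def by blast
qed

lemma C_rd_derivative_chain:
  assumes "y \<in> C_rd T r"
  shows "derivative_chain (\<lambda>j. delta_deriv_n T j y)"
  unfolding derivative_chain_def
proof (intro conjI allI impI ballI)
  fix j t assume j: "j < r" "t \<in> (kappa ^^ Suc j) T"
  then obtain D where D: "has_delta_derivative ((kappa ^^ j) T) (delta_deriv_n T j y) D t"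
    using assms unfolding C_rd_def by blast
  then show "has_delta_derivative ((kappa ^^ j) T) (delta_deriv_n T j y) (delta_deriv_n T (Suc j) y t) t"
    using delta_deriv_eqI[OF ts[OF j(1)] _ D] j by simp
qed (use assms in \<open>simp add: C_rd_def\<close>)

lemma derivative_chain_lincomb:
  assumes "derivative_chain z" "derivative_chain w"
  shows "derivative_chain (\<lambda>j t. z j t + c *\<^sub>R w j t)"
  unfolding derivative_chain_def
proof (intro conjI allI impI ballI)
  fix j t assume j: "j < r" "t \<in> (kappa ^^ Suc j) T"
  then have "t \<in> (kappa ^^ j) T" using kappa_subset by auto
  then show "has_delta_derivative ((kappa ^^ j) T) (\<lambda>t. z j t + c *\<^sub>R w j t)
      (z (Suc j) t + c *\<^sub>R w (Suc j) t) t"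
    using assms j unfolding derivative_chain_def
    by (intro has_delta_derivative_add[OF ts] has_delta_derivative_scaleR[OF ts]) auto
next
  show "rd_continuous ((kappa ^^ (r - 1)) T) (\<lambda>t. z r t + c *\<^sub>R w r t)"
    using assms unfolding derivative_chain_def
    by (intro rd_continuous_add rd_continuous_linear[OF _ bounded_linear_scaleR_right]) auto
qed

lemma C_rd_lincomb:
  assumes "y \<in> C_rd T r" "h \<in> C_rd T r"
  shows "(\<lambda>t. y t + c *\<^sub>R h t) \<in> C_rd T r"
    and "j \<le> r \<Longrightarrow> t \<in> (kappa ^^ j) T \<Longrightarrow>
      delta_deriv_n T j (\<lambda>t. y t + c *\<^sub>R h t) t = delta_deriv_n T j y t + c *\<^sub>R delta_deriv_n T j h t"
proof -
  note chain = derivative_chain_lincomb[OF assms[THEN C_rd_derivative_chain], of c]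
  show "(\<lambda>t. y t + c *\<^sub>R h t) \<in> C_rd T r"
    by (rule derivative_chain_in_C_rd[OF chain]) simp
  show "delta_deriv_n T j (\<lambda>t. y t + c *\<^sub>R h t) t = delta_deriv_n T j y t + c *\<^sub>R delta_deriv_n T j h t"
    if "j \<le> r" "t \<in> (kappa ^^ j) T"
    by (rule derivative_chain_delta_deriv_n[OF chain _ that]) simp
qed

lemma C_rd_zero: "(\<lambda>t. 0) \<in> C_rd T r"
  and delta_deriv_n_zero: "j \<le> r \<Longrightarrow> t \<in> (kappa ^^ j) T \<Longrightarrow> delta_deriv_n T j (\<lambda>t. 0) t = 0"
proof -
  have chain: "derivative_chain (\<lambda>j t. 0)"
    by (simp add: derivative_chain_def has_delta_derivative_const rd_continuous_const)
  show "(\<lambda>t. 0) \<in> C_rd T r" by (rule derivative_chain_in_C_rd[OF chain]) simp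
  show "delta_deriv_n T j (\<lambda>t. 0) t = 0" if "j \<le> r" "t \<in> (kappa ^^ j) T"
    by (rule derivative_chain_delta_deriv_n[OF chain _ that]) simp
qed

text \<open>
  Integrate \<open>u\<close> repeatedly, starting with the order \<open>r - 1\<close>. The function of order \<open>j\<close> is an integral over
  \<open>T\<^sub>j\<close>, hence continuous on \<open>T\<^sub>j\<close>, which is \<open>kappa\<close> of the set over which it is integrated
  next.
\<close>
lemma derivative_chain_exists:
  fixes u :: "real \<Rightarrow> 'a::{banach,real_inner}"
  assumes u: "rd_continuous ((kappa ^^ (r - 1)) T) u"
  shows "\<exists>z. derivative_chain z \<and> z r = u \<and> (\<forall>i<r. z i (Inf T) = \<xi> i)"
proof -
  \<comment> \<open>\<open>w k\<close> is the member of order \<open>r - k\<close>.\<close>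
  define w where "w = rec_nat u (\<lambda>k v t. \<xi> (r - 1 - k) +
      delta_integral ((kappa ^^ (r - 1 - k)) T) v (Inf T) t)"
  have w0: "w 0 = u" by (simp add: w_def)
  have wSuc: "w (Suc k) = (\<lambda>t. \<xi> (r - 1 - k) +
      delta_integral ((kappa ^^ (r - 1 - k)) T) (w k) (Inf T) t)" for k by (simp add: w_def)
  have deriv: "has_delta_derivative ((kappa ^^ (r - 1 - k)) T) (w (Suc k)) (w k t) t"
    if k: "k < r" and rd: "rd_continuous ((kappa ^^ (r - 1 - k)) T) (w k)"
      and t: "t \<in> kappa ((kappa ^^ (r - 1 - k)) T)" for k t
  proof -
    have S: "time_scale ((kappa ^^ (r - 1 - k)) T)" using ts k by simp
    have "has_delta_derivative ((kappa ^^ (r - 1 - k)) T) (w (Suc k)) (0 + w k t) t"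
      unfolding wSuc
      using has_delta_derivative_integral[OF S rd t] Inf_funpow[of "r - 1 - k"] k t kappa_subset
      by (intro has_delta_derivative_add[OF S _ has_delta_derivative_const]) auto
    then show ?thesis by simp
  qed
  have rd: "rd_continuous ((kappa ^^ (r - 1 - k)) T) (w k)" if "k < r" for k
    using that
  proof (induction k)
    case 0
    then show ?case using u by (simp add: w0)
  next
    case (Suc k)
    have S: "time_scale ((kappa ^^ (r - 1 - k)) T)" using ts Suc by simp
    have "continuous_on ((kappa ^^ (r - 1 - k)) T) (w (Suc k))"
      using Suc deriv by (intro has_delta_derivative_imp_continuous_on[OF S, of _ "w k"]) auto
    moreover have "(kappa ^^ (r - 1 - k)) T = kappa ((kappa ^^ (r - 1 - Suc k)) T)"
      using Suc.prems by (simp add: kappa_Suc Suc_diff_Suc del: funpow.simps)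
    ultimately show ?case by (simp add: continuous_imp_rd_continuous)
  qed
  define z where "z j = w (r - j)" for j
  have "derivative_chain z"
    unfolding derivative_chain_def
  proof (intro conjI allI impI ballI)
    fix j t assume j: "j < r" "t \<in> (kappa ^^ Suc j) T"
    have eq: "r - 1 - (r - Suc j) = j" "r - j = Suc (r - Suc j)" using j by auto
    show "has_delta_derivative ((kappa ^^ j) T) (z j) (z (Suc j) t) t"
      using deriv[of "r - Suc j" t] rd[of "r - Suc j"] j unfolding z_def eq by (simp add: eq)
  qed (use u in \<open>simp add: z_def w0\<close>)
  moreover have "z i (Inf T) = \<xi> i" if "i < r" for i
  proof -
    have eq: "r - i = Suc (r - Suc i)" "r - 1 - (r - Suc i) = i" using that by auto
    have S: "time_scale ((kappa ^^ i) T)" by (rule ts[OF that])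
    have "delta_integral ((kappa ^^ i) T) (w (r - Suc i)) (Inf T) (Inf T) = 0"
      using delta_integral_eq[OF S, of "w (r - i)" "w (r - Suc i)" "Inf T" "Inf T"]
        deriv[of "r - Suc i"] rd[of "r - Suc i"] Inf_in[OF S] Inf_funpow[OF that] that eq by simp
    then show ?thesis using wSuc[of "r - Suc i"] eq by (simp add: z_def)
  qed
  ultimately show ?thesis by (intro exI[of _ z]) (simp add: z_def w0)
qed

lemma derivative_chain_continuous:
  assumes "derivative_chain z" "i < r"
  shows "continuous_on ((kappa ^^ i) T) (z i)"
  using assms
  by (intro has_delta_derivative_imp_continuous_on[OF ts, of i _ "z (Suc i)"])
    (auto simp: derivative_chain_def)

text \<open>
  Each step is an instance of \<open>has_delta_derivative_kappa\<close>. The required continuity of the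
  derivative \<open>z (Suc i)\<close> holds because for \<open>Suc i < r\<close> it is itself differentiable.
\<close>
lemma derivative_chain_restrict:
  fixes z :: "nat \<Rightarrow> real \<Rightarrow> 'a::{banach,real_inner}"
  assumes z: "derivative_chain z" and "i \<le> j" "j < r" "t \<in> (kappa ^^ Suc j) T"
  shows "has_delta_derivative ((kappa ^^ j) T) (z i) (z (Suc i) t) t"
  using assms(2-4)
proof (induction j arbitrary: t rule: dec_induct)
  case base
  then show ?case using z by (simp add: derivative_chain_def)
next
  case (step j)
  have "continuous_on ((kappa ^^ Suc j) T) (z (Suc i))"
    using derivative_chain_continuous[OF z, of "Suc i"] kappa_funpow_antimono[of "Suc i" "Suc j" T]
      step continuous_on_subset by auto
  then show ?case
    using has_delta_derivative_kappa[OF ts[of j], of "z i" "z (Suc i)" t] ts[of "Suc j"] step by simp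
qed

lemma derivative_chain_last:
  fixes z :: "nat \<Rightarrow> real \<Rightarrow> 'a::{banach,real_inner}"
  assumes "derivative_chain z" "i < r" "t \<in> (kappa ^^ r) T"
  shows "has_delta_derivative ((kappa ^^ (r - 1)) T) (z i) (z (Suc i) t) t"
  using derivative_chain_restrict[OF assms(1), of i "r - 1" t] assms(2,3) r by auto

lemma derivative_chain_rd_continuous:
  assumes z: "derivative_chain z" and "i \<le> r"
  shows "rd_continuous ((kappa ^^ (r - 1)) T) (z i)"
proof (cases "i = r")
  case False
  then have "continuous_on ((kappa ^^ r) T) (z i)"
    using derivative_chain_continuous[OF z, of i] kappa_funpow_antimono[of i r T] assms(2)
      continuous_on_subset by auto
  then show ?thesis by (simp add: continuous_imp_rd_continuous kappa_last del: One_nat_def)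
qed (use z in \<open>simp add: derivative_chain_def\<close>)

end


section \<open>Gradients of functions of vector tuples\<close>

lemma bounded_linear_axis: "bounded_linear (axis i :: 'a::euclidean_space \<Rightarrow> 'a^'m)"
  by (intro linear_conv_bounded_linear[THEN iffD1] linearI) (simp_all add: axis_def vec_eq_iff)

lemma sum_axis_component:
  assumes "inj_on e I" "finite I" "j \<in> I"
  shows "(\<Sum>i\<in>I. axis (e i) (v i)) $ e j = (v j :: 'a::comm_monoid_add)"
proof -
  have "(\<Sum>i\<in>I. axis (e i) (v i)) $ e j = (\<Sum>i\<in>I. if i = j then v i else 0)"
    using assms by (auto simp: axis_def inj_on_eq_iff intro!: sum.cong)
  then show ?thesis using assms by simp
qed

lemma inner_sum_axis:
  fixes g :: "'a::real_inner^'m"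
  shows "g \<bullet> (\<Sum>i\<in>I. axis (e i) (v i)) = (\<Sum>i\<in>I. g $ e i \<bullet> v i)"
  by (simp add: inner_sum_right inner_axis)

lemma vec_vec_expansion:
  fixes h :: "real^'n^'m"
  shows "h = (\<Sum>j\<in>UNIV. \<Sum>k\<in>UNIV. (h $ j $ k) *\<^sub>R axis j (axis k 1))"
proof -
  have component: "((h $ j $ k) *\<^sub>R axis j (axis k 1)) $ j' $ k' =
      (if j = j' then if k = k' then h $ j $ k else 0 else 0)" for j j' :: 'm and k k' :: 'n
    by (simp add: axis_def)
  have "(\<Sum>k\<in>UNIV. if j = j' then if k = k' then h $ j $ k else 0 else 0) =
      (if j = j' then h $ j $ k' else 0)" for j j' :: 'm and k' :: 'n
    by simp
  then show ?thesis by (simp only: vec_eq_iff sum_component component) simp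
qed

text \<open>
  All partial gradients in one vector, so that the derivative of \<open>f\<close> in the direction of a jet is a single
  inner product.
\<close>
definition gradient :: "(real^'n^'m \<Rightarrow> real) \<Rightarrow> real^'n^'m \<Rightarrow> real^'n^'m" where
  "gradient f u = (\<chi> j. partial_grad f j u)"

lemma has_derivative_gradient:
  fixes f :: "real^'n^'m \<Rightarrow> real"
  assumes "f differentiable (at u)"
  shows "(f has_derivative (\<lambda>h. gradient f u \<bullet> h)) (at u)"
proof -
  let ?D = "frechet_derivative f (at u)"
  have D: "(f has_derivative ?D) (at u)" using assms by (simp add: frechet_derivative_works)
  then interpret bounded_linear ?D by (rule has_derivative_bounded_linear)
  have "?D h = gradient f u \<bullet> h" for h
    by (subst vec_vec_expansion)
      (simp add: sum scaleR inner_vec_def gradient_def partial_grad_def mult.commute)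
  then have "?D = (\<lambda>h. gradient f u \<bullet> h)" by auto
  with D show ?thesis by simp
qed

lemma Ck_continuous_gradient:
  fixes f :: "real^'n^'m \<Rightarrow> real"
  assumes "Ck (Suc (Suc k)) f"
  shows "continuous_on UNIV (gradient f)"
proof -
  have "axis j (axis k (1::real)) \<in> (Basis :: (real^'n^'m) set)" for j k
    by (simp add: axis_in_Basis_iff)
  then have "continuous_on UNIV (\<lambda>u. frechet_derivative f (at u) (axis j (axis k 1)))" for j k
    using assms by (auto intro: differentiable_imp_continuous_on)
  then show ?thesis unfolding gradient_def partial_grad_def
    by (intro continuous_on_vec_lambda)
qed

lemma rd_continuous_param_gradient:
  fixes L :: "real \<Rightarrow> real^'n^'m \<Rightarrow> real"
  assumes "\<And>j. rd_continuous_param T (\<lambda>t. partial_grad (L t) j)"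
  shows "rd_continuous_param T (\<lambda>t. gradient (L t))"
proof -
  let ?g = "\<lambda>j (s, v). partial_grad (L s) j v"
  have eq: "(\<lambda>(s, v). gradient (L s) v) = (\<lambda>p. \<chi> j. ?g j p)"
    by (auto simp: gradient_def)
  have lim: "((\<lambda>(s, v). gradient (L s) v) \<longlongrightarrow> (\<chi> j. l j)) F" if "\<And>j. (?g j \<longlongrightarrow> l j) F" for l F
    unfolding eq by (rule vec_tendstoI) (simp only: vec_lambda_beta that)
  show ?thesis unfolding rd_continuous_param_def
  proof (intro ballI allI conjI impI)
    fix t u assume t: "t \<in> kappa T"
    show "continuous (at (t, u) within (kappa T \<times> UNIV)) (\<lambda>(s, v). gradient (L s) v)"
      if "sigma T t = t"
    proof -
      have "(?g j \<longlongrightarrow> partial_grad (L t) j u) (at (t, u) within (kappa T \<times> UNIV))" for j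
        using assms[of j] t that by (auto simp: rd_continuous_param_def continuous_within)
      from lim[OF this] show ?thesis by (simp add: continuous_within gradient_def)
    qed
    show "\<exists>l. ((\<lambda>(s, v). gradient (L s) v) \<longlongrightarrow> l) (at (t, u) within ((kappa T \<inter> {..<t}) \<times> UNIV))"
      if "rho T t = t"
    proof -
      have "\<exists>l. (?g j \<longlongrightarrow> l) (at (t, u) within ((kappa T \<inter> {..<t}) \<times> UNIV))" for j
        using assms[of j] t that unfolding rd_continuous_param_def by blast
      then obtain l where "\<And>j. (?g j \<longlongrightarrow> l j) (at (t, u) within ((kappa T \<inter> {..<t}) \<times> UNIV))"
        by metis
      from lim[OF this] show ?thesis by blast
    qed
  qed
qed


section \<open>Differentiation under the delta integral\<close>

text \<open>
  By the mean value inequality the integrand is approximated by its linearization at \<open>s = 0\<close> up to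
  \<open>|s|\<close> times the oscillation of \<open>G\<close> on a tube around \<open>w\<close>. That oscillation is small uniformly in \<open>t\<close>, so the
  estimate can be integrated.
\<close>
lemma first_variation:
  fixes L :: "real \<Rightarrow> 'v::euclidean_space \<Rightarrow> real" and G :: "real \<Rightarrow> 'v \<Rightarrow> 'v"
  assumes T: "time_scale T"
    and deriv: "\<And>t u. t \<in> kappa T \<Longrightarrow> (L t has_derivative (\<lambda>h. G t u \<bullet> h)) (at u)"
    and cont: "\<And>t. t \<in> kappa T \<Longrightarrow> continuous_on UNIV (G t)"
    and L: "rd_continuous_param T L" and G: "rd_continuous_param T G"
    and w: "rd_continuous T w" and h: "rd_continuous T h"
  shows "((\<lambda>s. delta_integral T (\<lambda>t. L t (w t + s *\<^sub>R h t)) (Inf T) (Sup T)) has_real_derivative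
      delta_integral T (\<lambda>t. G t (w t) \<bullet> h t) (Inf T) (Sup T)) (at 0)"
proof -
  define J where "J s = delta_integral T (\<lambda>t. L t (w t + s *\<^sub>R h t)) (Inf T) (Sup T)" for s
  define D where "D = delta_integral T (\<lambda>t. G t (w t) \<bullet> h t) (Inf T) (Sup T)"
  obtain M where M: "M > 0" "\<And>t. t \<in> kappa T \<Longrightarrow> norm (h t) \<le> M"
    using rd_continuous_bounded[OF T h] by blast
  define C where "C = M * (Sup T - Inf T)"
  have C: "C > 0" using M Inf_less_Sup[OF T] by (simp add: C_def)
  obtain F1 where F1: "\<And>t. t \<in> kappa T \<Longrightarrow> has_delta_derivative T F1 (G t (w t) \<bullet> h t) t"
    using rd_continuous_antiderivative[OF T rd_continuous_inner[OF rd_continuous_param_compose[OF G w] h]]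
    by blast
  have wh: "rd_continuous T (\<lambda>t. w t + s *\<^sub>R h t)" for s
    by (intro rd_continuous_add w rd_continuous_linear[OF h bounded_linear_scaleR_right])
  have "\<exists>F. \<forall>s. \<forall>t\<in>kappa T. has_delta_derivative T (F s) (L t (w t + s *\<^sub>R h t)) t"
    by (rule choice) (use rd_continuous_antiderivative[OF T rd_continuous_param_compose[OF L wh]] in blast)
  then obtain F where F: "\<And>s t. t \<in> kappa T \<Longrightarrow> has_delta_derivative T (F s) (L t (w t + s *\<^sub>R h t)) t"
    by blast
  note int_eq = delta_integral_eq[OF T _ Inf_in[OF T] Sup_in[OF T]]
  have J_eq: "J s = F s (Sup T) - F s (Inf T)" for s unfolding J_def by (rule int_eq) (rule F)
  have D_eq: "D = F1 (Sup T) - F1 (Inf T)" unfolding D_def by (rule int_eq) (rule F1)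
  \<comment> \<open>The tolerance \<open>e / C\<close> is chosen so that integrating the pointwise error over \<open>T\<close> gives \<open>e \<bar>s\<bar>\<close>.\<close>
  have small: "\<exists>d>0. \<forall>s. \<bar>s\<bar> < d \<longrightarrow> \<bar>J s - J 0 - s * D\<bar> \<le> e * \<bar>s\<bar>" if e: "e > 0" for e
  proof -
    obtain d where d: "d > 0" "\<And>t v. t \<in> kappa T \<Longrightarrow> dist v (w t) < d \<Longrightarrow>
        dist (G t v) (G t (w t)) < e / C"
      using rd_continuous_param_uniform[OF T G w cont, of "e / C"] e C by fastforce
    have bound: "\<bar>L t (w t + s *\<^sub>R h t) - L t (w t) - s * (G t (w t) \<bullet> h t)\<bar> \<le> \<bar>s\<bar> * M * (e / C)"
      if s: "\<bar>s\<bar> < d / M" and t: "t \<in> kappa T" for s t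
    proof -
      have sh: "norm (s *\<^sub>R h t) \<le> \<bar>s\<bar> * M" using M(2)[OF t] by (simp add: mult_left_mono)
      also have "\<bar>s\<bar> * M < d" using s M(1) by (simp add: field_simps)
      finally have near: "norm (s *\<^sub>R h t) < d" .
      have "norm (L t (w t + s *\<^sub>R h t) - L t (w t) - G t (w t) \<bullet> (w t + s *\<^sub>R h t - w t))
          \<le> norm (w t + s *\<^sub>R h t - w t) * (e / C)"
      proof (rule differentiable_bound_linearization[where S = "ball (w t) d" and f' = "\<lambda>u h. G t u \<bullet> h"])
        fix \<theta> :: real assume "\<theta> \<in> {0..1}"
        then have "\<bar>\<theta>\<bar> * norm (s *\<^sub>R h t) \<le> 1 * norm (s *\<^sub>R h t)" by (intro mult_right_mono) auto
        then show "w t + \<theta> *\<^sub>R (w t + s *\<^sub>R h t - w t) \<in> ball (w t) d"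
          using near by (simp add: dist_norm abs_mult mult.assoc)
      next
        fix u assume "u \<in> ball (w t) d"
        then have close: "norm (G t u - G t (w t)) < e / C" using d(2)[OF t, of u] by (simp add: dist_norm norm_minus_commute)
        have "onorm (\<lambda>h. G t u \<bullet> h - G t (w t) \<bullet> h) \<le> e / C"
        proof (rule onorm_bound)
          fix x
          have "norm (G t u \<bullet> x - G t (w t) \<bullet> x) \<le> norm (G t u - G t (w t)) * norm x"
            using Cauchy_Schwarz_ineq2[of "G t u - G t (w t)" x] by (simp add: inner_diff_left)
          also have "\<dots> \<le> e / C * norm x" using close by (intro mult_right_mono) auto
          finally show "norm (G t u \<bullet> x - G t (w t) \<bullet> x) \<le> e / C * norm x" .
        qed (use e C in simp)
        then show "onorm ((\<bullet>) (G t u) - (\<bullet>) (G t (w t))) \<le> e / C" by (simp add: fun_diff_def)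
        show "(L t has_derivative (\<bullet>) (G t u)) (at u within ball (w t) d)"
          using deriv[OF t, of u] by (rule has_derivative_at_withinI)
      qed (use d in simp)
      also have "\<dots> \<le> \<bar>s\<bar> * M * (e / C)"
        using sh e C by (intro mult_right_mono) auto
      finally show ?thesis by simp
    qed
    have "\<bar>J s - J 0 - s * D\<bar> \<le> e * \<bar>s\<bar>" if s: "\<bar>s\<bar> < d / M" for s
    proof -
      define H where "H = (\<lambda>t. F s t - F 0 t - s *\<^sub>R F1 t)"
      have "has_delta_derivative T H (L t (w t + s *\<^sub>R h t) - L t (w t + 0 *\<^sub>R h t) - s *\<^sub>R (G t (w t) \<bullet> h t)) t"
        if t: "t \<in> kappa T" for t
        unfolding H_def using t kappa_subset[of T]
        by (intro has_delta_derivative_diff has_delta_derivative_scaleR T F F1) auto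
      then have "\<bar>H (Sup T) - H (Inf T)\<bar> \<le> \<bar>s\<bar> * M * (e / C) * (Sup T - Inf T)"
        using bound[OF s] by (intro delta_antiderivative_bound[OF T]) auto
      also have "\<dots> = C * (e / C) * \<bar>s\<bar>" by (simp add: C_def)
      also have "\<dots> = e * \<bar>s\<bar>" using C by simp
      finally show ?thesis by (simp add: H_def J_eq D_eq algebra_simps)
    qed
    then show ?thesis using d(1) M(1) by (intro exI[of _ "d / M"]) auto
  qed
  have "(J has_derivative (*) D) (at 0)"
    unfolding has_derivative_within_alt
    using small by (auto simp: bounded_linear_mult_right mult.commute)
  then show ?thesis
    unfolding J_def[symmetric] D_def[symmetric] has_field_derivative_def .
qed


section \<open>The adjoint equation\<close>

text \<open>
  The recursion \<open>\<psi>\<^sub>i\<^sup>\<Delta> = - (p\<^sub>i + \<psi>\<^sub>i\<^sub>-\<^sub>1 \<circ> \<sigma>)\<close>, normalised at the right end: \<open>d\<close> gives the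
  terminal values. The multipliers of the right boundary conditions enter there.
\<close>
primrec adjoint_state :: "real set \<Rightarrow> (nat \<Rightarrow> real \<Rightarrow> 'a::real_normed_vector) \<Rightarrow> (nat \<Rightarrow> 'a) \<Rightarrow>
    nat \<Rightarrow> real \<Rightarrow> 'a" where
  "adjoint_state T p d 0 = (\<lambda>t. d 0 + delta_integral T (p 0) (Inf T) (Sup T) -
      delta_integral T (p 0) (Inf T) t)"
| "adjoint_state T p d (Suc i) = (\<lambda>t. d (Suc i) +
      delta_integral T (\<lambda>\<xi>. p (Suc i) \<xi> + adjoint_state T p d i (sigma T \<xi>)) (Inf T) (Sup T) -
      delta_integral T (\<lambda>\<xi>. p (Suc i) \<xi> + adjoint_state T p d i (sigma T \<xi>)) (Inf T) t)"

text \<open>One formula for the negated derivatives of all orders, which saves the case distinction on \<open>i\<close>.\<close>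
definition adjoint_rhs :: "real set \<Rightarrow> (nat \<Rightarrow> real \<Rightarrow> 'a::real_normed_vector) \<Rightarrow> (nat \<Rightarrow> 'a) \<Rightarrow>
    nat \<Rightarrow> real \<Rightarrow> 'a" where
  "adjoint_rhs T p d i \<xi> = p i \<xi> + (if i = 0 then 0 else adjoint_state T p d (i - 1) (sigma T \<xi>))"

lemma adjoint_state_eq:
  "adjoint_state T p d i t = d i + delta_integral T (adjoint_rhs T p d i) (Inf T) (Sup T) -
    delta_integral T (adjoint_rhs T p d i) (Inf T) t"
  by (cases i) (simp_all add: adjoint_rhs_def[abs_def])

lemma adjoint_state_Sup: "adjoint_state T p d i (Sup T) = d i"
  by (simp add: adjoint_state_eq)

lemma adjoint_state_deriv:
  fixes p :: "nat \<Rightarrow> real \<Rightarrow> 'a::{banach,real_inner}"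
  assumes T: "time_scale T" and p: "\<And>j. j \<le> i \<Longrightarrow> rd_continuous T (p j)"
  shows "rd_continuous T (adjoint_rhs T p d i)"
    and "t \<in> kappa T \<Longrightarrow>
      has_delta_derivative T (adjoint_state T p d i) (- adjoint_rhs T p d i t) t"
    and "continuous_on T (adjoint_state T p d i)"
proof -
  have "rd_continuous T (adjoint_rhs T p d i) \<and>
    (\<forall>t\<in>kappa T. has_delta_derivative T (adjoint_state T p d i) (- adjoint_rhs T p d i t) t) \<and>
    continuous_on T (adjoint_state T p d i)"
    using p
  proof (induction i)
    case 0
    have rd: "rd_continuous T (adjoint_rhs T p d 0)" using 0 by (simp add: adjoint_rhs_def[abs_def])
    have "has_delta_derivative T (adjoint_state T p d 0) (0 - adjoint_rhs T p d 0 t) t"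
      if "t \<in> kappa T" for t
      unfolding adjoint_state_eq[abs_def] using that kappa_subset
      by (intro has_delta_derivative_diff[OF T] has_delta_derivative_const
          has_delta_derivative_integral[OF T rd]) auto
    with rd show ?case using has_delta_derivative_imp_continuous_on[OF T, of "adjoint_state T p d 0"]
      by fastforce
  next
    case (Suc i)
    then have c: "continuous_on T (adjoint_state T p d i)" by simp
    have rd: "rd_continuous T (adjoint_rhs T p d (Suc i))"
      using rd_continuous_add[OF _ rd_continuous_sigma[OF T c], of "p (Suc i)"] Suc.prems
      by (simp add: adjoint_rhs_def[abs_def])
    have "has_delta_derivative T (adjoint_state T p d (Suc i)) (0 - adjoint_rhs T p d (Suc i) t) t"
      if "t \<in> kappa T" for t
      unfolding adjoint_state_eq[abs_def] using that kappa_subset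
      by (intro has_delta_derivative_diff[OF T] has_delta_derivative_const
          has_delta_derivative_integral[OF T rd]) auto
    with rd show ?case using has_delta_derivative_imp_continuous_on[OF T, of "adjoint_state T p d (Suc i)"]
      by fastforce
  qed
  then show "rd_continuous T (adjoint_rhs T p d i)"
    "t \<in> kappa T \<Longrightarrow> has_delta_derivative T (adjoint_state T p d i) (- adjoint_rhs T p d i t) t"
    "continuous_on T (adjoint_state T p d i)" by auto
qed

text \<open>
  In the product rule the term \<open>\<psi>\<^sub>i(\<sigma>(t)) \<bullet> z\<^sub>i\<^sub>+\<^sub>1(t)\<close> cancels against the coupling term in the
  derivative of \<open>\<psi>\<^sub>i\<^sub>+\<^sub>1\<close>; only the last one remains.
\<close>
lemma adjoint_pairing_deriv:
  fixes p z :: "nat \<Rightarrow> real \<Rightarrow> 'a::{banach,real_inner}"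
  assumes T: "time_scale T" and p: "\<And>i. i \<le> k \<Longrightarrow> rd_continuous T (p i)"
    and z: "\<And>i. i \<le> k \<Longrightarrow> has_delta_derivative T (z i) (z (Suc i) t) t" and t: "t \<in> kappa T"
  shows "has_delta_derivative T (\<lambda>s. \<Sum>i\<le>k. adjoint_state T p d i s \<bullet> z i s)
    (adjoint_state T p d k (sigma T t) \<bullet> z (Suc k) t - (\<Sum>i\<le>k. p i t \<bullet> z i t)) t"
proof -
  let ?\<psi> = "adjoint_state T p d"
  have tT: "t \<in> T" using t kappa_subset by blast
  have "has_delta_derivative T (\<lambda>s. \<Sum>i\<le>k. ?\<psi> i s \<bullet> z i s)
      (\<Sum>i\<le>k. - adjoint_rhs T p d i t \<bullet> z i t + ?\<psi> i (sigma T t) \<bullet> z (Suc i) t) t"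
    using p z t by (intro has_delta_derivative_sum[OF T tT]
        has_delta_derivative_bilinear[OF T tT bounded_bilinear_inner] adjoint_state_deriv(2)[OF T]) auto
  also have "(\<Sum>i\<le>k. - adjoint_rhs T p d i t \<bullet> z i t + ?\<psi> i (sigma T t) \<bullet> z (Suc i) t) =
      ?\<psi> k (sigma T t) \<bullet> z (Suc k) t - (\<Sum>i\<le>k. p i t \<bullet> z i t)"
    by (induction k) (simp_all add: adjoint_rhs_def inner_diff_left)
  finally show ?thesis .
qed

text \<open>
  Integrate the derivative of \<open>\<Sum>\<^sub>i \<psi>\<^sub>i \<bullet> z\<^sub>i\<close> over \<open>T\<close>, insert the terminal values \<open>d i\<close> of \<open>\<psi>\<^sub>i\<close>, and add the
  term \<open>p\<^sub>k\<^sub>+\<^sub>1 \<bullet> z\<^sub>k\<^sub>+\<^sub>1\<close> on both sides, which completes the sum to the integrand of the first variation.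
\<close>
lemma adjoint_green_identity:
  fixes p z :: "nat \<Rightarrow> real \<Rightarrow> 'a::{banach,real_inner}"
  assumes T: "time_scale T" and p: "\<And>i. i \<le> Suc k \<Longrightarrow> rd_continuous T (p i)"
    and rd: "\<And>i. i \<le> Suc k \<Longrightarrow> rd_continuous T (z i)"
    and z: "\<And>i t. i \<le> k \<Longrightarrow> t \<in> kappa T \<Longrightarrow> has_delta_derivative T (z i) (z (Suc i) t) t"
  shows "delta_integral T (\<lambda>t. (adjoint_state T p d k (sigma T t) + p (Suc k) t) \<bullet> z (Suc k) t) (Inf T) (Sup T) =
    (\<Sum>i\<le>k. d i \<bullet> z i (Sup T)) - (\<Sum>i\<le>k. adjoint_state T p d i (Inf T) \<bullet> z i (Inf T)) +
    delta_integral T (\<lambda>t. \<Sum>i\<le>Suc k. p i t \<bullet> z i t) (Inf T) (Sup T)"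
proof -
  let ?\<psi> = "adjoint_state T p d"
  have "rd_continuous T (\<lambda>t. \<Sum>i\<le>Suc k. p i t \<bullet> z i t)"
    using p rd by (intro rd_continuous_sum rd_continuous_inner) auto
  then obtain F where F: "\<And>t. t \<in> kappa T \<Longrightarrow> has_delta_derivative T F (\<Sum>i\<le>Suc k. p i t \<bullet> z i t) t"
    using rd_continuous_antiderivative[OF T] by blast
  define N where "N = (\<lambda>s. (\<Sum>i\<le>k. ?\<psi> i s \<bullet> z i s) + F s)"
  have N: "has_delta_derivative T N ((?\<psi> k (sigma T t) + p (Suc k) t) \<bullet> z (Suc k) t) t"
    if t: "t \<in> kappa T" for t
  proof -
    have "has_delta_derivative T N (?\<psi> k (sigma T t) \<bullet> z (Suc k) t - (\<Sum>i\<le>k. p i t \<bullet> z i t) +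
        (\<Sum>i\<le>Suc k. p i t \<bullet> z i t)) t"
      unfolding N_def using t kappa_subset[of T] p z
      by (intro has_delta_derivative_add[OF T] adjoint_pairing_deriv[OF T] F) auto
    then show ?thesis by (simp add: inner_add_left)
  qed
  note int = delta_integral_eq[OF T _ Inf_in[OF T] Sup_in[OF T]]
  have "delta_integral T (\<lambda>t. (?\<psi> k (sigma T t) + p (Suc k) t) \<bullet> z (Suc k) t) (Inf T) (Sup T) =
      N (Sup T) - N (Inf T)" by (rule int) (rule N)
  moreover have "delta_integral T (\<lambda>t. \<Sum>i\<le>Suc k. p i t \<bullet> z i t) (Inf T) (Sup T) =
      F (Sup T) - F (Inf T)" by (rule int) (rule F)
  ultimately show ?thesis
    by (simp only: N_def adjoint_state_Sup)
qed


section \<open>Multipliers for the boundary conditions\<close>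

text \<open>
  If \<open>S\<close> consists of the pairs \<open>(M h, \<Lambda> h)\<close> for linear \<open>M\<close> and \<open>\<Lambda>\<close>, the hypothesis says that \<open>\<Lambda>\<close>
  vanishes on the kernel of \<open>M\<close>, and the conclusion that \<open>\<Lambda>\<close> is a linear function of \<open>M\<close>. Only the
  range of \<open>M\<close> occurs, so its domain may be infinite-dimensional. A vector orthogonal to \<open>S\<close> but not
  to \<open>(0, 1)\<close> yields \<open>\<mu>\<close>.
\<close>
lemma graph_of_functional_factors:
  fixes S :: "('e::euclidean_space \<times> real) set"
  assumes S: "subspace S" and zero: "\<And>l. (0, l) \<in> S \<Longrightarrow> l = 0"
  shows "\<exists>\<mu>. \<forall>(m, l)\<in>S. l = \<mu> \<bullet> m"
proof -
  obtain y n where y: "y \<in> span S" and n: "\<And>w. w \<in> span S \<Longrightarrow> orthogonal n w" and eq: "(0, 1) = y + n"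
    using orthogonal_subspace_decomp_exists[of S "(0, 1)"] by metis
  have "(0, 1) \<notin> span S" using S zero span_eq_iff by fastforce
  then have "n \<noteq> 0" using eq y by auto
  have "n \<bullet> n = n \<bullet> (0, 1)" unfolding eq using n[OF y] by (simp add: orthogonal_def inner_add_right)
  then have snd: "snd n \<noteq> 0" using \<open>n \<noteq> 0\<close> by (auto simp: inner_prod_def prod_eq_iff)
  have "l = (- (1 / snd n) *\<^sub>R fst n) \<bullet> m" if "(m, l) \<in> S" for m l
  proof -
    have "n \<bullet> (m, l) = 0" using n span_base[OF that] by (simp add: orthogonal_def)
    then have "snd n * l = - (fst n \<bullet> m)" by (simp add: inner_prod_def)
    then show ?thesis using snd by (simp add: field_simps)
  qed
  then show ?thesis by blast
qed

context iterated_time_scale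
begin

lemma mem_kappa_funpow: "t \<in> (kappa ^^ r) T \<Longrightarrow> i \<le> r \<Longrightarrow> t \<in> (kappa ^^ i) T"
  using kappa_funpow_antimono by blast

lemma ends_mem: 
  assumes "i < r"
  shows "Inf T \<in> (kappa ^^ i) T" "Sup ((kappa ^^ (r - 1)) T) \<in> (kappa ^^ i) T"
proof -
  show "Inf T \<in> (kappa ^^ i) T" using Inf_in[OF ts[OF assms]] Inf_funpow[OF assms] by simp
  have "i \<le> r - 1" using assms by simp
  then show "Sup ((kappa ^^ (r - 1)) T) \<in> (kappa ^^ i) T"
    using Sup_in[OF ts_last] kappa_funpow_antimono by blast
qed

lemma jet_lincomb:
  assumes "y \<in> C_rd T r" "h \<in> C_rd T r" "t \<in> (kappa ^^ r) T"
  shows "jet T r e (\<lambda>t. y t + c *\<^sub>R h t) t = jet T r e y t + c *\<^sub>R jet T r e h t"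
proof -
  have "axis (e i) (delta_deriv_n T i (\<lambda>t. y t + c *\<^sub>R h t) t) =
      axis (e i) (delta_deriv_n T i y t) + c *\<^sub>R axis (e i) (delta_deriv_n T i h t)" if "i \<le> r" for i
    using C_rd_lincomb(2)[OF assms(1,2) that mem_kappa_funpow[OF assms(3) that]]
    by (simp add: linear_simps[OF bounded_linear_axis])
  then show ?thesis by (simp add: jet_def sum.distrib scaleR_sum_right)
qed

lemma jet_rd_continuous:
  assumes "y \<in> C_rd T r"
  shows "rd_continuous ((kappa ^^ (r - 1)) T) (jet T r e y)"
  unfolding jet_def[abs_def]
  using derivative_chain_rd_continuous[OF C_rd_derivative_chain[OF assms]]
  by (intro rd_continuous_sum rd_continuous_linear[OF _ bounded_linear_axis]) auto

text \<open>The multiples \<open>c h\<close> of a fixed variation are admissible for the weak minimum once \<open>c\<close> is small.\<close>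
lemma norm_r_inf_scaleR_le:
  fixes h :: "real \<Rightarrow> real^'n"
  assumes h: "h \<in> C_rd T r"
  shows "\<exists>N>0. \<forall>c. norm_r_inf T r (\<lambda>t. c *\<^sub>R h t) \<le> \<bar>c\<bar> * N"
proof -
  have "\<exists>M>0. \<forall>t\<in>(kappa ^^ r) T. norm (delta_deriv_n T i h t) \<le> M" if "i \<le> r" for i
    using rd_continuous_bounded[OF ts_last derivative_chain_rd_continuous[OF C_rd_derivative_chain[OF h] that]]
    unfolding kappa_last .
  then obtain M where M: "\<And>i. i \<le> r \<Longrightarrow> M i > 0"
    "\<And>i t. i \<le> r \<Longrightarrow> t \<in> (kappa ^^ r) T \<Longrightarrow> norm (delta_deriv_n T i h t) \<le> M i" by metis
  have "norm_r_inf T r (\<lambda>t. c *\<^sub>R h t) \<le> \<bar>c\<bar> * (\<Sum>i\<le>r. M i)" for c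
    unfolding norm_r_inf_def sum_distrib_left
  proof (intro sum_mono cSUP_least)
    show "(kappa ^^ r) T \<noteq> {}" using Inf_in_kappa[OF ts_last] unfolding kappa_last by blast
    fix i t assume i: "i \<in> {..r}" and t: "t \<in> (kappa ^^ r) T"
    have tk: "t \<in> (kappa ^^ i) T" using mem_kappa_funpow t i by simp
    have "delta_deriv_n T i (\<lambda>t. c *\<^sub>R h t) t = c *\<^sub>R delta_deriv_n T i h t"
      using C_rd_lincomb(2)[OF C_rd_zero h _ tk, of c] delta_deriv_n_zero[OF _ tk] i by simp
    then show "norm (delta_deriv_n T i (\<lambda>t. c *\<^sub>R h t) t) \<le> \<bar>c\<bar> * M i"
      using M(2)[of i t] i t by (simp add: mult_left_mono)
  qed
  moreover have "(\<Sum>i\<le>r. M i) > 0" using M(1) by (intro sum_pos) auto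
  ultimately show ?thesis by blast
qed

text \<open>
  The curves \<open>y + s h\<close> satisfy the boundary conditions that \<open>y\<close> satisfies, so the functional has a
  local minimum at \<open>s = 0\<close> along them.
\<close>
lemma first_variation_eq_0:
  fixes y h :: "real \<Rightarrow> real^'n" and L :: "real \<Rightarrow> real^'n^'m \<Rightarrow> real"
  assumes min: "weak_local_minimizer T r e L A B ya yb y"
    and h: "h \<in> C_rd T r"
    and hA: "\<And>i. i < r \<Longrightarrow> i \<in> A \<Longrightarrow> delta_deriv_n T i h (Inf T) = 0"
    and hB: "\<And>i. i < r \<Longrightarrow> i \<in> B \<Longrightarrow> delta_deriv_n T i h (Sup ((kappa ^^ (r - 1)) T)) = 0"
    and Ck: "\<And>t. t \<in> (kappa ^^ r) T \<Longrightarrow> Ck (r + 1) (L t)"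
    and L: "rd_continuous_param ((kappa ^^ (r - 1)) T) L"
    and G: "rd_continuous_param ((kappa ^^ (r - 1)) T) (\<lambda>t. gradient (L t))"
  shows "delta_integral ((kappa ^^ (r - 1)) T) (\<lambda>t. gradient (L t) (jet T r e y t) \<bullet> jet T r e h t)
    (Inf T) (Sup ((kappa ^^ (r - 1)) T)) = 0"
proof -
  let ?T = "(kappa ^^ (r - 1)) T"
  have ends: "Inf ?T = Inf T" "Sup ?T = (rho T ^^ (r - 1)) (Sup T)"
    using Inf_funpow[of "r - 1"] Sup_funpow[of "r - 1"] r by simp_all
  obtain \<delta> where y: "y \<in> C_rd T r" "boundary_conditions T r A B ya yb y" and \<delta>: "\<delta> > 0"
    and opt: "\<And>x. x \<in> C_rd T r \<Longrightarrow> boundary_conditions T r A B ya yb x \<Longrightarrow>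
      norm_r_inf T r (\<lambda>t. x t - y t) < \<delta> \<Longrightarrow> lagrangian_functional T r e L y \<le> lagrangian_functional T r e L x"
    using min unfolding weak_local_minimizer_def by blast
  define J where "J s = delta_integral ?T (\<lambda>t. L t (jet T r e y t + s *\<^sub>R jet T r e h t)) (Inf ?T) (Sup ?T)" for s
  have functional: "lagrangian_functional T r e L (\<lambda>t. y t + s *\<^sub>R h t) = J s" for s
    unfolding lagrangian_functional_def J_def ends
    by (rule delta_integral_cong) (simp only: kappa_last jet_lincomb[OF y(1) h])
  obtain k where k: "r = Suc k" using r by (cases r) auto
  have deriv: "(J has_real_derivative
      delta_integral ?T (\<lambda>t. gradient (L t) (jet T r e y t) \<bullet> jet T r e h t) (Inf ?T) (Sup ?T)) (at 0)"
    unfolding J_def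
  proof (rule first_variation[OF ts_last _ _ L G jet_rd_continuous[OF y(1)] jet_rd_continuous[OF h]])
    fix t u assume "t \<in> kappa ?T"
    then have C: "Ck (Suc (Suc k)) (L t)" using Ck[of t] unfolding kappa_last by (simp add: k)
    then have "L t differentiable (at u)" by (simp add: differentiable_on_def)
    then show "(L t has_derivative (\<bullet>) (gradient (L t) u)) (at u)" by (rule has_derivative_gradient)
    show "continuous_on UNIV (gradient (L t))" by (rule Ck_continuous_gradient[OF C])
  qed
  obtain N where N: "N > 0" "\<And>c. norm_r_inf T r (\<lambda>t. c *\<^sub>R h t) \<le> \<bar>c\<bar> * N"
    using norm_r_inf_scaleR_le[OF h] by blast
  have "J 0 \<le> J s" if "\<bar>0 - s\<bar> < \<delta> / N" for s
  proof -
    have bc: "boundary_conditions T r A B ya yb (\<lambda>t. y t + s *\<^sub>R h t)"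
      using y(2) hA hB unfolding boundary_conditions_def ends(2)[symmetric]
      by (auto simp: C_rd_lincomb(2)[OF y(1) h] ends_mem simp del: One_nat_def)
    have near: "norm_r_inf T r (\<lambda>t. (y t + s *\<^sub>R h t) - y t) < \<delta>"
    proof -
      have "\<bar>s\<bar> * N < \<delta>" using that N(1) by (simp add: field_simps)
      then show ?thesis using N(2)[of s] by simp
    qed
    have "lagrangian_functional T r e L y \<le> J s"
      using opt[OF C_rd_lincomb(1)[OF y(1) h] bc near] unfolding functional .
    then show ?thesis using functional[of 0] by simp
  qed
  then show ?thesis
    using DERIV_local_min[OF deriv, of "\<delta> / N"] \<delta> N(1) ends(1) by simp
qed

text \<open>
  The first variation vanishes on the common kernel of the constrained boundary functionals. Those are
  collected in a pair of elements of \<open>real^'n^'m\<close>, one for each end point, with zero entries at the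
  unconstrained orders.
\<close>
lemma boundary_multipliers:
  fixes y :: "real \<Rightarrow> real^'n" and L :: "real \<Rightarrow> real^'n^'m::finite \<Rightarrow> real"
  assumes min: "weak_local_minimizer T r e L A B ya yb y"
    and e: "inj_on e {..<r}"
    and Ck: "\<And>t. t \<in> (kappa ^^ r) T \<Longrightarrow> Ck (r + 1) (L t)"
    and L: "rd_continuous_param ((kappa ^^ (r - 1)) T) L"
    and G: "rd_continuous_param ((kappa ^^ (r - 1)) T) (\<lambda>t. gradient (L t))"
  shows "\<exists>\<mu> \<nu> :: nat \<Rightarrow> real^'n. (\<forall>i. i \<notin> A \<longrightarrow> \<mu> i = 0) \<and> (\<forall>i. i \<notin> B \<longrightarrow> \<nu> i = 0) \<and>
    (\<forall>h\<in>C_rd T r. delta_integral ((kappa ^^ (r - 1)) T)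
        (\<lambda>t. gradient (L t) (jet T r e y t) \<bullet> jet T r e h t) (Inf T) (Sup ((kappa ^^ (r - 1)) T)) =
      (\<Sum>i<r. \<mu> i \<bullet> delta_deriv_n T i h (Inf T)) +
      (\<Sum>i<r. \<nu> i \<bullet> delta_deriv_n T i h (Sup ((kappa ^^ (r - 1)) T))))"
proof -
  let ?T = "(kappa ^^ (r - 1)) T" and ?\<beta> = "Sup ((kappa ^^ (r - 1)) T)"
  have y: "y \<in> C_rd T r" using min by (simp add: weak_local_minimizer_def)
  define \<Lambda> where "\<Lambda> h = delta_integral ?T (\<lambda>t. gradient (L t) (jet T r e y t) \<bullet> jet T r e h t) (Inf T) ?\<beta>" for h
  define M where "M C \<tau> h = (\<Sum>i<r. axis (e i) (if i \<in> C then delta_deriv_n T i h \<tau> else 0))"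
    for C \<tau> and h :: "real \<Rightarrow> real^'n"
  define \<Phi> where "\<Phi> h = ((M A (Inf T) h, M B ?\<beta> h), \<Lambda> h)" for h
  have Glin: "rd_continuous ?T (\<lambda>t. gradient (L t) (jet T r e y t) \<bullet> jet T r e h t)" if "h \<in> C_rd T r" for h
    by (intro rd_continuous_inner rd_continuous_param_compose[OF G] jet_rd_continuous y that)
  have \<Lambda>: "\<Lambda> (\<lambda>t. f t + c *\<^sub>R h t) = \<Lambda> f + c *\<^sub>R \<Lambda> h" if "f \<in> C_rd T r" "h \<in> C_rd T r" for f h c
  proof -
    have "\<Lambda> (\<lambda>t. f t + c *\<^sub>R h t) = delta_integral ?T (\<lambda>t. gradient (L t) (jet T r e y t) \<bullet> jet T r e f t +
        c *\<^sub>R (gradient (L t) (jet T r e y t) \<bullet> jet T r e h t)) (Inf T) ?\<beta>"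
      unfolding \<Lambda>_def
      by (rule delta_integral_cong) (simp only: kappa_last jet_lincomb[OF that] inner_add_right inner_scaleR_right real_scaleR_def)
    also have "\<dots> = \<Lambda> f + c *\<^sub>R \<Lambda> h"
      unfolding \<Lambda>_def
      using delta_integral_lincomb[OF ts_last Glin[OF that(1)] Glin[OF that(2)]] ends_mem[of "r - 1"] r by simp
    finally show ?thesis .
  qed
  have M: "M C \<tau> (\<lambda>t. f t + c *\<^sub>R h t) = M C \<tau> f + c *\<^sub>R M C \<tau> h"
    if "f \<in> C_rd T r" "h \<in> C_rd T r" "\<And>i. i < r \<Longrightarrow> \<tau> \<in> (kappa ^^ i) T" for f h c C \<tau>
    unfolding M_def scaleR_sum_right sum.distrib[symmetric]
    by (rule sum.cong) (auto simp: C_rd_lincomb(2)[OF that(1,2)] that(3) linear_simps[OF bounded_linear_axis])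
  have \<Phi>: "\<Phi> (\<lambda>t. f t + c *\<^sub>R h t) = \<Phi> f + c *\<^sub>R \<Phi> h" if "f \<in> C_rd T r" "h \<in> C_rd T r" for f h c
    using M[OF that] \<Lambda>[OF that] ends_mem by (simp add: \<Phi>_def)
  have \<Phi>0: "\<Phi> (\<lambda>t. 0) = 0"
    using \<Phi>[OF C_rd_zero C_rd_zero, of 1] by simp
  have "subspace (\<Phi> ` C_rd T r)"
  proof (rule subspaceI)
    show "0 \<in> \<Phi> ` C_rd T r" using \<Phi>0 C_rd_zero by (metis imageI)
    show "x + v \<in> \<Phi> ` C_rd T r" if xv: "x \<in> \<Phi> ` C_rd T r" "v \<in> \<Phi> ` C_rd T r" for x v
    proof -
      obtain f h where fh: "f \<in> C_rd T r" "h \<in> C_rd T r" "x = \<Phi> f" "v = \<Phi> h" using xv by blast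
      have "x + v = \<Phi> (\<lambda>t. f t + 1 *\<^sub>R h t)" using \<Phi>[OF fh(1,2), of 1] fh by simp
      then show ?thesis using C_rd_lincomb(1)[OF fh(1,2), of 1] by blast
    qed
    show "c *\<^sub>R x \<in> \<Phi> ` C_rd T r" if "x \<in> \<Phi> ` C_rd T r" for c x
    proof -
      obtain h where h: "h \<in> C_rd T r" "x = \<Phi> h" using \<open>x \<in> \<Phi> ` C_rd T r\<close> by blast
      have "c *\<^sub>R x = \<Phi> (\<lambda>t. 0 + c *\<^sub>R h t)" using \<Phi>[OF C_rd_zero h(1), of c] h \<Phi>0 by simp
      then show ?thesis using C_rd_lincomb(1)[OF C_rd_zero h(1), of c] by blast
    qed
  qed
  moreover have "l = 0" if "(0, l) \<in> \<Phi> ` C_rd T r" for l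
  proof -
    obtain h where h: "h \<in> C_rd T r" "M A (Inf T) h = 0" "M B ?\<beta> h = 0" "l = \<Lambda> h"
      using \<open>(0, l) \<in> \<Phi> ` C_rd T r\<close> by (auto simp: \<Phi>_def zero_prod_def)
    have "delta_deriv_n T i h \<tau> = 0" if "i < r" "i \<in> C" "M C \<tau> h = 0" for i C \<tau>
    proof -
      have "M C \<tau> h $ e i = (if i \<in> C then delta_deriv_n T i h \<tau> else 0)"
        unfolding M_def by (rule sum_axis_component[OF e finite_lessThan]) (simp add: that)
      then show ?thesis using that by simp
    qed
    then show ?thesis
      using first_variation_eq_0[OF min h(1) _ _ Ck L G] h by (simp add: \<Lambda>_def)
  qed
  ultimately obtain m where m: "\<forall>(x, l)\<in>\<Phi> ` C_rd T r. l = m \<bullet> x"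
    using graph_of_functional_factors[of "\<Phi> ` C_rd T r"] by blast
  have inner_M: "g \<bullet> M C \<tau> h = (\<Sum>i<r. (if i \<in> C then g $ e i else 0) \<bullet> delta_deriv_n T i h \<tau>)" for g C \<tau> h
    unfolding M_def inner_sum_axis by (intro sum.cong) auto
  have "\<Lambda> h = (\<Sum>i<r. (if i \<in> A then fst m $ e i else 0) \<bullet> delta_deriv_n T i h (Inf T)) +
      (\<Sum>i<r. (if i \<in> B then snd m $ e i else 0) \<bullet> delta_deriv_n T i h ?\<beta>)" if "h \<in> C_rd T r" for h
  proof -
    have "\<Phi> h \<in> \<Phi> ` C_rd T r" using that by blast
    then have "\<Lambda> h = m \<bullet> (M A (Inf T) h, M B ?\<beta> h)" using m by (auto simp: \<Phi>_def)
    then show ?thesis by (simp add: inner_prod_def inner_M)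
  qed
  then show ?thesis unfolding \<Lambda>_def
    by (intro exI[of _ "\<lambda>i. if i \<in> A then fst m $ e i else 0"]
        exI[of _ "\<lambda>i. if i \<in> B then snd m $ e i else 0"]) simp
qed

text \<open>
  Two families of chains are inserted into Green's identity: the one with top member \<open>q\<close> and zero
  initial values, and those with top member \<open>0\<close> and a single nonzero initial value.
\<close>
lemma weak_local_minimizer_adjoint_state:
  fixes y :: "real \<Rightarrow> real^'n" and L :: "real \<Rightarrow> real^'n^'m::finite \<Rightarrow> real"
  assumes min: "weak_local_minimizer T r e L A B ya yb y"
    and e: "bij_betw e {..r} UNIV"
    and Ck: "\<And>t. t \<in> (kappa ^^ r) T \<Longrightarrow> Ck (r + 1) (L t)"
    and L: "rd_continuous_param ((kappa ^^ (r - 1)) T) L"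
    and Lgrad: "\<And>i. i \<le> r \<Longrightarrow> rd_continuous_param ((kappa ^^ (r - 1)) T) (\<lambda>t. partial_grad (L t) (e i))"
  defines "p \<equiv> \<lambda>i t. partial_grad (L t) (e i) (jet T r e y t)"
  shows "\<exists>d. (\<forall>t\<in>(kappa ^^ r) T.
      adjoint_state ((kappa ^^ (r - 1)) T) p d (r - 1) (sigma ((kappa ^^ (r - 1)) T) t) = - p r t) \<and>
    (\<forall>i<r. (i \<notin> A \<longrightarrow> adjoint_state ((kappa ^^ (r - 1)) T) p d i (Inf T) = 0) \<and> (i \<notin> B \<longrightarrow> d i = 0))"
proof -
  let ?T = "(kappa ^^ (r - 1)) T" and ?\<beta> = "Sup ((kappa ^^ (r - 1)) T)"
  obtain k where k: "r = Suc k" using r by (cases r) auto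
  have y: "y \<in> C_rd T r" using min by (simp add: weak_local_minimizer_def)
  have Inf_eq: "Inf ?T = Inf T" using Inf_funpow[of "r - 1"] r by simp
  have G: "rd_continuous_param ?T (\<lambda>t. gradient (L t))"
  proof (rule rd_continuous_param_gradient)
    fix j
    obtain i where "i \<le> r" "j = e i" using e unfolding bij_betw_def by force
    then show "rd_continuous_param ?T (\<lambda>t. partial_grad (L t) j)" using Lgrad by blast
  qed
  have "inj_on e {..<r}" using e by (auto simp: bij_betw_def intro: inj_on_subset)
  from boundary_multipliers[OF min this Ck L G] obtain \<mu> \<nu> where
    \<mu>: "\<And>i. i \<notin> A \<Longrightarrow> \<mu> i = 0" and \<nu>: "\<And>i. i \<notin> B \<Longrightarrow> \<nu> i = 0"
    and \<Lambda>: "\<And>h. h \<in> C_rd T r \<Longrightarrow>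
      delta_integral ?T (\<lambda>t. gradient (L t) (jet T r e y t) \<bullet> jet T r e h t) (Inf T) ?\<beta> =
      (\<Sum>i<r. \<mu> i \<bullet> delta_deriv_n T i h (Inf T)) + (\<Sum>i<r. \<nu> i \<bullet> delta_deriv_n T i h ?\<beta>)"
    by blast
  let ?\<psi> = "adjoint_state ?T p (\<lambda>i. - \<nu> i)"
  define q where "q t = ?\<psi> (r - 1) (sigma ?T t) + p r t" for t
  have p: "rd_continuous ?T (p i)" if "i \<le> r" for i
    unfolding p_def using that by (intro rd_continuous_param_compose[OF Lgrad] jet_rd_continuous[OF y])
  have q: "rd_continuous ?T q"
    unfolding q_def[abs_def] using p
    by (intro rd_continuous_add rd_continuous_sigma[OF ts_last] adjoint_state_deriv(3)[OF ts_last]) auto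
  \<comment> \<open>Green's identity and the multiplier formula combined: the terms at the right end cancel.\<close>
  have key: "delta_integral ?T (\<lambda>t. q t \<bullet> z r t) (Inf T) ?\<beta> = (\<Sum>i<r. (\<mu> i - ?\<psi> i (Inf T)) \<bullet> z i (Inf T))"
    if z: "derivative_chain z" for z
  proof -
    have zC: "z 0 \<in> C_rd T r" by (rule derivative_chain_in_C_rd[OF z refl])
    have dz: "delta_deriv_n T i (z 0) t = z i t" if "i \<le> r" "t \<in> (kappa ^^ i) T" for i t
      by (rule derivative_chain_delta_deriv_n[OF z refl that])
    have "delta_integral ?T (\<lambda>t. \<Sum>i\<le>r. p i t \<bullet> z i t) (Inf T) ?\<beta> =
        delta_integral ?T (\<lambda>t. gradient (L t) (jet T r e y t) \<bullet> jet T r e (z 0) t) (Inf T) ?\<beta>"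
    proof (rule delta_integral_cong)
      fix t assume "t \<in> kappa ?T"
      then have "t \<in> (kappa ^^ r) T" unfolding kappa_last .
      then show "(\<Sum>i\<le>r. p i t \<bullet> z i t) = gradient (L t) (jet T r e y t) \<bullet> jet T r e (z 0) t"
        unfolding jet_def[of T r e "z 0"] inner_sum_axis
        by (intro sum.cong) (auto simp: dz mem_kappa_funpow gradient_def p_def)
    qed
    also have "\<dots> = (\<Sum>i<r. \<mu> i \<bullet> z i (Inf T)) + (\<Sum>i<r. \<nu> i \<bullet> z i ?\<beta>)"
      unfolding \<Lambda>[OF zC] by (intro arg_cong2[where f = "(+)"] sum.cong) (auto simp: dz ends_mem simp del: One_nat_def)
    finally have \<Lambda>z: "delta_integral ?T (\<lambda>t. \<Sum>i\<le>r. p i t \<bullet> z i t) (Inf T) ?\<beta> = \<dots>" .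
    have "delta_integral ?T (\<lambda>t. q t \<bullet> z (Suc k) t) (Inf ?T) ?\<beta> =
        (\<Sum>i\<le>k. - \<nu> i \<bullet> z i ?\<beta>) - (\<Sum>i\<le>k. ?\<psi> i (Inf ?T) \<bullet> z i (Inf ?T)) +
        delta_integral ?T (\<lambda>t. \<Sum>i\<le>Suc k. p i t \<bullet> z i t) (Inf ?T) ?\<beta>"
      unfolding q_def k diff_Suc_1
      using p derivative_chain_rd_continuous[OF z] derivative_chain_last[OF z] ts_last kappa_last
      by (intro adjoint_green_identity) (auto simp: k)
    moreover have "{..k} = {..<r}" by (auto simp: k)
    ultimately show ?thesis
      unfolding Inf_eq k[symmetric] \<Lambda>z
      by (simp add: inner_diff_left sum_subtractf sum_negf)
  qed
  have q0: "q t = 0" if t: "t \<in> (kappa ^^ r) T" for t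
  proof -
    obtain z where "derivative_chain z" "z r = q" "\<forall>i<r. z i (Inf T) = 0"
      using derivative_chain_exists[OF q, of "\<lambda>_. 0"] by blast
    then have "delta_integral ?T (\<lambda>t. q t \<bullet> q t) (Inf ?T) ?\<beta> = 0"
      using key[of z] unfolding Inf_eq by simp
    then show ?thesis
      using delta_integral_inner_self_eq_0[OF ts_last q] t unfolding kappa_last by blast
  qed
  have "?\<psi> j (Inf T) = \<mu> j" if j: "j < r" for j
  proof -
    define v where "v = \<mu> j - ?\<psi> j (Inf T)"
    obtain z :: "nat \<Rightarrow> real \<Rightarrow> real^'n" where z: "derivative_chain z" "z r = (\<lambda>t. 0)"
      "\<forall>i<r. z i (Inf T) = (if i = j then v else 0)"
      using derivative_chain_exists[OF rd_continuous_const, of 0 "\<lambda>i. if i = j then v else 0"] by blast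
    have "delta_integral ?T (\<lambda>t. q t \<bullet> z r t) (Inf T) ?\<beta> = 0 - 0"
      using ends_mem[of "r - 1"] r unfolding z(2)
      by (intro delta_integral_eq[OF ts_last]) (simp_all add: has_delta_derivative_const)
    then have "0 = (\<Sum>i<r. (\<mu> i - ?\<psi> i (Inf T)) \<bullet> z i (Inf T))"
      unfolding key[OF z(1)] by simp
    also have "\<dots> = (\<Sum>i<r. if i = j then v \<bullet> v else 0)"
      by (rule sum.cong) (simp_all add: z(3) v_def)
    also have "\<dots> = v \<bullet> v" using j by simp
    finally show ?thesis by (simp add: v_def)
  qed
  then show ?thesis
    using q0 \<mu> \<nu> by (intro exI[of _ "\<lambda>i. - \<nu> i"]) (auto simp: q_def add_eq_0_iff2)
qed

end

theorem theorem4: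
  fixes T0 T T1 :: "real set" and a b \<beta> :: real and r :: nat
    and e :: "nat \<Rightarrow> 'm::finite"
    and L :: "real \<Rightarrow> real^'n^'m \<Rightarrow> real"
    and A B :: "nat set" and ya yb :: "nat \<Rightarrow> real^'n"
    and y :: "real \<Rightarrow> real^'n"
  assumes "closed T0" and "T = {a..b} \<inter> T0" and "a < b" and "a \<in> T" and "b \<in> T"
    and "r \<ge> 1" and "infinite T \<or> card T \<ge> 2 * r + 1"
    and "T1 = (kappa ^^ (r - 1)) T" and "\<beta> = (rho T ^^ (r - 1)) b"
    and "bij_betw e {..r} UNIV"
    and "\<And>t. t \<in> T \<Longrightarrow> Ck (r + 1) (L t)"
    and "rd_continuous_param T1 L"
    and "\<And>i. i \<le> r \<Longrightarrow> rd_continuous_param T1 (\<lambda>t. partial_grad (L t) (e i))"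
    and "weak_local_minimizer T r e L A B ya yb y"
  shows "\<exists>(c :: nat \<Rightarrow> real^'n) (\<psi> :: nat \<Rightarrow> real \<Rightarrow> real^'n).
     (\<forall>t\<in>T1. \<psi> 0 t =
        - delta_integral T1 (\<lambda>\<xi>. partial_grad (L \<xi>) (e 0) (jet T r e y \<xi>)) a t + c 0) \<and>
     (\<forall>i\<in>{1..r - 1}. \<forall>t\<in>T1. \<psi> i t =
        - delta_integral T1
            (\<lambda>\<xi>. partial_grad (L \<xi>) (e i) (jet T r e y \<xi>) + \<psi> (i - 1) (sigma T1 \<xi>)) a t + c i) \<and>
     (\<forall>t\<in>(kappa ^^ r) T.
        \<psi> (r - 1) (sigma T1 t) = - partial_grad (L t) (e r) (jet T r e y t)) \<and>
     (\<forall>i<r. (i \<notin> A \<longrightarrow> \<psi> i a = 0) \<and> (i \<notin> B \<longrightarrow> \<psi> i \<beta> = 0))"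
proof -
  have "compact T" using assms(1,2) by (simp add: compact_Int_closed)
  then interpret iterated_time_scale T r
    using assms(6,7) time_scale_kappa_funpow[of T "2 * r"] by unfold_locales auto
  have a: "Inf T = a"
    using assms(2,4) by (intro cInf_eq_minimum) auto
  have b: "Sup T = b"
    using assms(2,5) by (intro cSup_eq_maximum) auto
  have \<beta>: "Sup T1 = \<beta>" using Sup_funpow[of "r - 1"] r b assms(8,9) by simp
  have a1: "Inf T1 = a" using Inf_funpow[of "r - 1"] r a assms(8) by simp
  define p where "p = (\<lambda>i t. partial_grad (L t) (e i) (jet T r e y t))"
  have "Ck (r + 1) (L t)" if "t \<in> (kappa ^^ r) T" for t
    using assms(11) mem_kappa_funpow[OF that, of 0] by simp
  then have "\<exists>d. (\<forall>t\<in>(kappa ^^ r) T. adjoint_state T1 p d (r - 1) (sigma T1 t) = - p r t) \<and>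
      (\<forall>i<r. (i \<notin> A \<longrightarrow> adjoint_state T1 p d i a = 0) \<and> (i \<notin> B \<longrightarrow> d i = 0))"
    using assms(12,13) unfolding p_def a[symmetric] assms(8)
    by (intro weak_local_minimizer_adjoint_state[OF assms(14,10)])
  then obtain d where d: "\<And>t. t \<in> (kappa ^^ r) T \<Longrightarrow> adjoint_state T1 p d (r - 1) (sigma T1 t) = - p r t"
    "\<And>i. i < r \<Longrightarrow> i \<notin> A \<Longrightarrow> adjoint_state T1 p d i a = 0" "\<And>i. i < r \<Longrightarrow> i \<notin> B \<Longrightarrow> d i = 0"
    by blast
  let ?\<psi> = "adjoint_state T1 p d"
  \<comment> \<open>The required form normalises at the left end, so \<open>c i\<close> is the value of \<open>\<psi>\<^sub>i\<close> at \<open>a\<close>.\<close>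
  define c where "c i = d i + delta_integral T1 (adjoint_rhs T1 p d i) a \<beta>" for i
  have \<psi>: "?\<psi> i t = - delta_integral T1 (adjoint_rhs T1 p d i) a t + c i" for i t
    by (simp add: adjoint_state_eq[of T1 p d i t] c_def a1 \<beta>)
  have rhs: "adjoint_rhs T1 p d 0 = p 0"
    "\<And>i. i \<noteq> 0 \<Longrightarrow> adjoint_rhs T1 p d i = (\<lambda>\<xi>. p i \<xi> + ?\<psi> (i - 1) (sigma T1 \<xi>))"
    by (auto simp: adjoint_rhs_def)
  have eqs: "\<forall>t\<in>T1. ?\<psi> 0 t = - delta_integral T1 (p 0) a t + c 0"
    "\<forall>i\<in>{1..r - 1}. \<forall>t\<in>T1. ?\<psi> i t =
      - delta_integral T1 (\<lambda>\<xi>. p i \<xi> + ?\<psi> (i - 1) (sigma T1 \<xi>)) a t + c i"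
  proof -
    show "\<forall>t\<in>T1. ?\<psi> 0 t = - delta_integral T1 (p 0) a t + c 0"
      using \<psi>[of 0] unfolding rhs(1) by blast
    show "\<forall>i\<in>{1..r - 1}. \<forall>t\<in>T1. ?\<psi> i t =
      - delta_integral T1 (\<lambda>\<xi>. p i \<xi> + ?\<psi> (i - 1) (sigma T1 \<xi>)) a t + c i"
    proof (intro ballI)
      fix i t assume "i \<in> {1..r - 1}"
      then have "i \<noteq> 0" by simp
      from \<psi>[of i t, unfolded rhs(2)[OF this]]
      show "?\<psi> i t = - delta_integral T1 (\<lambda>\<xi>. p i \<xi> + ?\<psi> (i - 1) (sigma T1 \<xi>)) a t + c i" .
    qed
  qed
  have ends: "\<forall>i<r. (i \<notin> A \<longrightarrow> ?\<psi> i a = 0) \<and> (i \<notin> B \<longrightarrow> ?\<psi> i \<beta> = 0)"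
    using d(2,3) adjoint_state_Sup[of T1 p d] unfolding \<beta> by simp
  show ?thesis
    using eqs d(1) ends unfolding p_def by blast
qed

end
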